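(* Let $\rho^0\in L^1(\mathbb{R}^2)\cap L^\infty(\mathbb{R}^2)$ with $\rho^0\ge0$. Let $\varepsilon>0$ and let $L>0$ be such that $$\iint_{\mathbb{R}^2\setminus[-L,L]^2}\rho^0(x,y)\,dx\,dy\le\varepsilon.$$ For every integer $N\ge1$ let $\hat\rho^{N,\varepsilon}$ be the piecewise constant density on $[-L,L]^2$ associated with $\rho^0$, $L$, $N$ (defined in the context). Then for every $\varphi\in C_c^\infty(\mathbb{R}^2)$ and every $N\ge 1$, $$\left|\iint_{\mathbb{R}^2}\hat\rho^{N,\varepsilon}(x,y)\varphi(x,y)\,dx\,dy-\iint_{\mathbb{R}^2}\rho^0(x,y)\varphi(x,y)\,dx\,dy\right|\le\varepsilon\|\varphi\|_\infty+\frac{D_\varepsilon(\varphi)}{N},$$ where $$D_\varepsilon(\varphi)=2L(\|\partial_x\varphi\|_\infty+\|\partial_y\varphi\|_\infty)(\|\rho^0\|_1+4L^2\|\rho^0\|_\infty).$$ Moreover, let $\omega^0\in L^\infty(\mathbb{R}^2)$ be such that $\partial_x\omega^0,\partial_y\omega^0\in L^\infty(\mathbb{R}^2)$, and let $\hat\rho^{N,\varepsilon}\hat\omega^{N,\varepsilon}$ be the associated piecewise constant quantity (defined in the context). Then for every $\varphi\in C_c^\infty(\mathbb{R}^2)$ and every $N\ge 1$, $$\left|\iint_{\mathbb{R}^2}(\hat\rho^{N,\varepsilon}\hat\omega^{N,\varepsilon})(x,y)\varphi(x,y)\,dx\,dy-\iint_{\mathbb{R}^2}\rho^0(x,y)\omega^0(x,y)\varphi(x,y)\,dx\,dy\right|\le\varepsilon\|\varphi\|_\infty\|\omega^0\|_\infty+\frac{K_\varepsilon(\varphi)+D_\varepsilon(\varphi)\|\omega^0\|_\infty}{N},$$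 where $$K_\varepsilon(\varphi)=2L(\|\partial_x\omega^0\|_\infty+\|\partial_y\omega^0\|_\infty)\|\varphi\|_\infty\|\rho^0\|_1.$$
   Context: Notation: given $L>0$, an integer $N\ge1$ and $k\in\{0,\dots,N\}$, $\overline{x}_k^N=\overline{y}_k^N=-L+k\frac{2L}{N}$. For $i,j\in\{0,\dots,N-1\}$, $$a_{i,j}^N=\frac{N^2}{4L^2}\int_{\overline{x}_i^N}^{\overline{x}_{i+1}^N}\int_{\overline{y}_j^N}^{\overline{y}_{j+1}^N}\rho^0(x,y)\,dy\,dx,\qquad W_{i,j}^N=\frac{N^2}{4L^2}\int_{\overline{x}_i^N}^{\overline{x}_{i+1}^N}\int_{\overline{y}_j^N}^{\overline{y}_{j+1}^N}\omega^0(x,y)\,dy\,dx.$$ The piecewise constant density (depending on $\varepsilon$ through $L$) is $$\hat\rho^{N,\varepsilon}(x,y)=\sum_{i=0}^{N-1}\sum_{j=0}^{N-1}a_{i,j}^N\,\mathbf{1}_{[\overline{x}_i^N,\overline{x}_{i+1}^N[}(x)\,\mathbf{1}_{[\overline{y}_j^N,\overline{y}_{j+1}^N[}(y),$$ and the piecewise constant quantity $\hat\rho^{N,\varepsilon}\hat\omega^{N,\varepsilon}$ (a single function) is $$(\hat\rho^{N,\varepsilon}\hat\omega^{N,\varepsilon})(x,y)=\sum_{i=0}^{N-1}\sum_{j=0}^{N-1}a_{i,j}^N W_{i,j}^N\,\mathbf{1}_{[\overline{x}_i^N,\overline{x}_{i+1}^N[}(x)\,\mathbf{1}_{[\overline{y}_j^N,\overline{y}_{j+1}^N[}(y).$$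 $\|\cdot\|_1$ and $\|\cdot\|_\infty$ are the norms of $L^1(\mathbb{R}^2)$ and $L^\infty(\mathbb{R}^2)$. Partial derivatives of $\omega^0$ are weak derivatives. *)

theory Defs
  imports "HOL-Analysis.Analysis" "HOL-Probability.Essential_Supremum"
begin

text \<open>
  The plane is \<^typ>\<open>real \<times> real\<close> with its Lebesgue measure. Elements of \<open>L\<^sup>1\<close> and \<open>L\<^sup>\<infinity>\<close> are
  represented by arbitrary Lebesgue measurable functions; membership in \<open>L\<^sup>1\<close> is
  \<open>integrable lebesgue\<close>.
\<close>

subsection \<open>Norms\<close>

definition L1_norm :: "(real \<times> real \<Rightarrow> real) \<Rightarrow> real" where
  "L1_norm f = (LINT z|lebesgue. \<bar>f z\<bar>)"

definition Linf :: "(real \<times> real \<Rightarrow> real) \<Rightarrow> bool" where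
  "Linf f \<longleftrightarrow> f \<in> borel_measurable lebesgue \<and> esssup lebesgue (\<lambda>z. ereal \<bar>f z\<bar>) < \<infinity>"

definition Linf_norm :: "(real \<times> real \<Rightarrow> real) \<Rightarrow> real" where
  "Linf_norm f = real_of_ereal (esssup lebesgue (\<lambda>z. ereal \<bar>f z\<bar>))"

subsection \<open>Partial derivatives and test functions\<close>

definition dx :: "(real \<times> real \<Rightarrow> real) \<Rightarrow> real \<times> real \<Rightarrow> real" where
  "dx f = (\<lambda>(x, y). deriv (\<lambda>t. f (t, y)) x)"

definition dy :: "(real \<times> real \<Rightarrow> real) \<Rightarrow> real \<times> real \<Rightarrow> real" where
  "dy f = (\<lambda>(x, y). deriv (\<lambda>t. f (x, t)) y)"

text \<open>\<open>C_k k f\<close>: all partial derivatives of \<open>f\<close> of order at most \<open>k\<close> exist and are continuous.\<close>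

fun C_k :: "nat \<Rightarrow> (real \<times> real \<Rightarrow> real) \<Rightarrow> bool" where
  "C_k 0 f \<longleftrightarrow> continuous_on UNIV f"
| "C_k (Suc k) f \<longleftrightarrow> continuous_on UNIV f
     \<and> (\<forall>x y. (\<lambda>t. f (t, y)) differentiable (at x))
     \<and> (\<forall>x y. (\<lambda>t. f (x, t)) differentiable (at y))
     \<and> C_k k (dx f) \<and> C_k k (dy f)"

definition test_fun :: "(real \<times> real \<Rightarrow> real) \<Rightarrow> bool" where
  "test_fun \<phi> \<longleftrightarrow> (\<forall>k. C_k k \<phi>) \<and> compact (closure (support_on UNIV \<phi>))"

subsection \<open>Weak derivatives\<close>

definition locally_integrable :: "(real \<times> real \<Rightarrow> real) \<Rightarrow> bool" where
  "locally_integrable f \<longleftrightarrow> (\<forall>C. compact C \<longrightarrow> set_integrable lebesgue C f)"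

definition weak_dx :: "(real \<times> real \<Rightarrow> real) \<Rightarrow> (real \<times> real \<Rightarrow> real) \<Rightarrow> bool" where
  "weak_dx f g \<longleftrightarrow> locally_integrable f \<and> locally_integrable g \<and>
     (\<forall>\<psi>. test_fun \<psi> \<longrightarrow>
       (LINT z|lebesgue. f z * dx \<psi> z) = - (LINT z|lebesgue. g z * \<psi> z))"

definition weak_dy :: "(real \<times> real \<Rightarrow> real) \<Rightarrow> (real \<times> real \<Rightarrow> real) \<Rightarrow> bool" where
  "weak_dy f g \<longleftrightarrow> locally_integrable f \<and> locally_integrable g \<and>
     (\<forall>\<psi>. test_fun \<psi> \<longrightarrow>
       (LINT z|lebesgue. f z * dy \<psi> z) = - (LINT z|lebesgue. g z * \<psi> z))"

subsection \<open>Piecewise constant approximations\<close>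

definition grid :: "real \<Rightarrow> nat \<Rightarrow> nat \<Rightarrow> real" where
  "grid L N k = - L + real k * (2 * L / real N)"

text \<open>The coefficients \<open>a\<^sub>i\<^sub>j\<close> and \<open>W\<^sub>i\<^sub>j\<close> are the cell averages of \<open>\<rho>\<^sup>0\<close> and \<open>\<omega>\<^sup>0\<close>.\<close>

definition cell_avg :: "real \<Rightarrow> nat \<Rightarrow> (real \<times> real \<Rightarrow> real) \<Rightarrow> nat \<Rightarrow> nat \<Rightarrow> real" where
  "cell_avg L N f i j = (real N)\<^sup>2 / (4 * L\<^sup>2) *
     (LINT x:{grid L N i..grid L N (Suc i)}|lebesgue.
       (LINT y:{grid L N j..grid L N (Suc j)}|lebesgue. f (x, y)))"

definition rho_hat :: "real \<Rightarrow> nat \<Rightarrow> (real \<times> real \<Rightarrow> real) \<Rightarrow> real \<times> real \<Rightarrow> real" where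
  "rho_hat L N \<rho> = (\<lambda>(x, y). \<Sum>i<N. \<Sum>j<N. cell_avg L N \<rho> i j
     * indicator {grid L N i..<grid L N (Suc i)} x
     * indicator {grid L N j..<grid L N (Suc j)} y)"

definition rho_omega_hat ::
  "real \<Rightarrow> nat \<Rightarrow> (real \<times> real \<Rightarrow> real) \<Rightarrow> (real \<times> real \<Rightarrow> real) \<Rightarrow> real \<times> real \<Rightarrow> real" where
  "rho_omega_hat L N \<rho> \<omega> = (\<lambda>(x, y). \<Sum>i<N. \<Sum>j<N. cell_avg L N \<rho> i j * cell_avg L N \<omega> i j
     * indicator {grid L N i..<grid L N (Suc i)} x
     * indicator {grid L N j..<grid L N (Suc j)} y)"

subsection \<open>The constants of the error estimates\<close>

definition D_const :: "real \<Rightarrow> (real \<times> real \<Rightarrow> real) \<Rightarrow> (real \<times> real \<Rightarrow> real) \<Rightarrow> real" where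
  "D_const L \<rho> \<phi> = 2 * L * (Linf_norm (dx \<phi>) + Linf_norm (dy \<phi>))
     * (L1_norm \<rho> + 4 * L\<^sup>2 * Linf_norm \<rho>)"

text \<open>\<open>\<omega>x\<close> and \<open>\<omega>y\<close> stand for the weak partial derivatives of \<open>\<omega>\<^sup>0\<close>.\<close>

definition K_const ::
  "real \<Rightarrow> (real \<times> real \<Rightarrow> real) \<Rightarrow> (real \<times> real \<Rightarrow> real) \<Rightarrow> (real \<times> real \<Rightarrow> real)
     \<Rightarrow> (real \<times> real \<Rightarrow> real) \<Rightarrow> real" where
  "K_const L \<rho> \<omega>x \<omega>y \<phi> =
     2 * L * (Linf_norm \<omega>x + Linf_norm \<omega>y) * Linf_norm \<phi> * L1_norm \<rho>"

end

theory Submission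
  imports Defs "HOL-Real_Asymp.Real_Asymp"
begin

text \<open>
  Both estimates are instances of one statement, \<open>weighted_grid_error\<close>, in which the density
  is multiplied by a bounded function \<open>\<omega>\<close> and \<open>\<omega>\<close> is replaced on each cell by a constant
  \<open>w\<close> with \<open>\<bar>w - \<omega>\<bar> \<le> \<kappa>\<close> there; \<open>\<omega> = w = 1\<close> gives the first estimate. Outside the square the
  difference of the two integrals is controlled by the tail mass \<open>\<epsilon>\<close>. On a cell, where \<open>a\<close> is
  the average of \<open>\<rho>\<close>, one writes
  \[ a w \phi - \rho \omega \phi
     = w k (a - \rho) + w (\phi - k) (a - \rho) + (w - \omega) \phi \rho \]
  with \<open>k\<close> the value of \<open>\<phi>\<close> at a corner. The first term has integral zero; in the second, \<open>\<phi>\<close>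
  varies by at most the mesh size times its Lipschitz constants, which gives \<open>D_const\<close>; the
  third is at most \<open>\<kappa>\<close> times the sup norm of \<open>\<phi>\<close> times the mass of \<open>\<rho>\<close> in the cell
  (\<open>average_replacement_error\<close>).

  For the second estimate \<open>w\<close> is the cell average of \<open>\<omega>\<close>, so \<open>\<kappa>\<close> has to bound the oscillation of
  \<open>\<omega>\<close> on a cell. This is the analytic core: a bounded function with bounded weak partial
  derivatives satisfies the Lipschitz inequality for almost every pair of points
  (\<open>weak_derivatives_AE_Lipschitz\<close>). Fubini's theorem and the fundamental theorem of calculus,
  applied to the test function, show that
  \[ f(z + s e) - f(z) - \int_0^s g(z + r e)\,dr \]
  is orthogonal to all test functions when \<open>g\<close> is the weak derivative of \<open>f\<close> in
  the direction \<open>e\<close>. By the fundamental lemma of the calculus of variations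
  (\<open>fundamental_lemma_bounded\<close>) it vanishes almost everywhere. That lemma requires
  enough test functions to approximate the indicators of rectangles; they are built from
  \<open>exp (- c / t)\<close>.
\<close>

section \<open>Essential bounds and test functions\<close>

text \<open>
  The essential supremum of \<open>\<bar>f\<bar>\<close> is neither \<open>- \<infinity>\<close>, since the plane is not a null set, nor
  \<open>\<infinity>\<close>, by assumption; so its conversion to a real number loses nothing.
\<close>

lemma Linf_AE_bound:
  assumes "Linf f"
  shows "AE z in lebesgue. \<bar>f z\<bar> \<le> Linf_norm f"
proof -
  let ?s = "esssup lebesgue (\<lambda>z. ereal \<bar>f z\<bar>)"
  have le: "AE z in lebesgue. ereal \<bar>f z\<bar> \<le> ?s"
    by (rule esssup_AE)
  have "?s \<ge> 0"
  proof (rule ccontr)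
    assume neg: "\<not> ?s \<ge> 0"
    have "AE z in lebesgue. z \<in> ({}::(real \<times> real) set)"
      using le
    proof eventually_elim
      case (elim z)
      have "0 \<le> ereal \<bar>f z\<bar>" by simp
      then show ?case using order_trans[OF _ elim] neg by blast
    qed
    then show False
      using mem_closed_if_AE_lebesgue[OF closed_empty] by blast
  qed
  then obtain r where r: "?s = ereal r"
    using assms unfolding Linf_def by (cases ?s) auto
  show ?thesis
    using le unfolding Linf_norm_def r by simp
qed

lemma Linf_norm_nonneg:
  assumes "Linf f"
  shows "Linf_norm f \<ge> 0"
proof (rule ccontr)
  assume neg: "\<not> Linf_norm f \<ge> 0"
  have "AE z in lebesgue. z \<in> ({}::(real \<times> real) set)"
    using Linf_AE_bound[OF assms] by eventually_elim (use neg in auto)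
  then show False
    using mem_closed_if_AE_lebesgue[OF closed_empty] by blast
qed

lemma continuous_imp_lebesgue_measurable:
  fixes f :: "real \<times> real \<Rightarrow> real"
  assumes "continuous_on UNIV f"
  shows "f \<in> borel_measurable lebesgue"
  using borel_measurable_continuous_onI[OF assms] by (simp add: measurable_completion)

lemma Linf_continuous_bounded:
  assumes "continuous_on UNIV f" and "\<And>z. \<bar>f z\<bar> \<le> C"
  shows "Linf f"
proof -
  have m: "f \<in> borel_measurable lebesgue"
    by (rule continuous_imp_lebesgue_measurable) fact
  have "esssup lebesgue (\<lambda>z. ereal \<bar>f z\<bar>) \<le> ereal C"
    using m assms(2) by (intro esssup_I) auto
  then show ?thesis
    unfolding Linf_def using m by auto
qed

text \<open>
  A closed set of full measure is everything, so for continuous functions the essential bound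
  holds at every point.
\<close>

lemma continuous_le_Linf_norm:
  assumes "continuous_on UNIV f" and "Linf f"
  shows "\<bar>f z\<bar> \<le> Linf_norm f"
proof -
  have "closed {z. \<bar>f z\<bar> \<le> Linf_norm f}"
    using assms(1) by (intro closed_Collect_le continuous_intros)
  then show ?thesis
    using mem_closed_if_AE_lebesgue[of "{z. \<bar>f z\<bar> \<le> Linf_norm f}" z] Linf_AE_bound[OF assms(2)]
    by simp
qed

lemma bounded_support_iff:
  "compact (closure (support_on UNIV f)) \<longleftrightarrow> (\<exists>R. \<forall>z. norm z > R \<longrightarrow> f z = 0)"
    for f :: "real \<times> real \<Rightarrow> real"
proof -
  have "compact (closure (support_on UNIV f)) \<longleftrightarrow> bounded (support_on UNIV f)"
    by (rule compact_closure)
  also have "\<dots> \<longleftrightarrow> (\<exists>R. \<forall>z. norm z > R \<longrightarrow> f z = 0)"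
    unfolding bounded_iff support_on_def by (auto simp: not_less[symmetric])
  finally show ?thesis .
qed

lemma test_funI:
  assumes "\<And>k. C_k k f" and "\<And>z. norm z > R \<Longrightarrow> f z = 0"
  shows "test_fun f"
  unfolding test_fun_def bounded_support_iff using assms by blast

lemma test_fun_C_k: "test_fun f \<Longrightarrow> C_k k f"
  by (simp add: test_fun_def)

lemma test_fun_support:
  assumes "test_fun f"
  obtains R where "\<And>z. norm z > R \<Longrightarrow> f z = 0"
  using assms unfolding test_fun_def bounded_support_iff by blast

lemma test_fun_continuous: "test_fun f \<Longrightarrow> continuous_on UNIV f"
  using test_fun_C_k[of f 0] by simp

lemma test_fun_has_dx:
  assumes "test_fun f"
  shows "((\<lambda>t. f (t, y)) has_real_derivative dx f (x, y)) (at x)"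
  using test_fun_C_k[OF assms, of 1] by (auto simp: dx_def DERIV_deriv_iff_real_differentiable)

lemma test_fun_has_dy:
  assumes "test_fun f"
  shows "((\<lambda>t. f (x, t)) has_real_derivative dy f (x, y)) (at y)"
  using test_fun_C_k[OF assms, of 1] by (auto simp: dy_def DERIV_deriv_iff_real_differentiable)

lemma vanishing_near_imp_DERIV_0:
  fixes g :: "real \<Rightarrow> real \<times> real" and f :: "real \<times> real \<Rightarrow> real"
  assumes "continuous_on UNIV g" and "\<And>z. norm z > R \<Longrightarrow> f z = 0" and "norm (g x) > R"
  shows "deriv (\<lambda>t. f (g t)) x = 0"
proof -
  have "open {t. norm (g t) > R}"
    using assms(1) by (intro open_Collect_less continuous_intros)
  then have "\<forall>\<^sub>F t in nhds x. norm (g t) > R"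
    using assms(3) by (simp add: eventually_nhds_in_open[of "{t. norm (g t) > R}", simplified])
  then have "\<forall>\<^sub>F t in nhds x. f (g t) = 0"
    by eventually_elim (rule assms(2))
  then have "deriv (\<lambda>t. f (g t)) x = deriv (\<lambda>t. 0) x"
    by (rule deriv_cong_ev) simp
  then show ?thesis by simp
qed

lemma test_fun_dx: assumes "test_fun f" shows "test_fun (dx f)"
proof -
  obtain R where R: "\<And>z. norm z > R \<Longrightarrow> f z = 0"
    using test_fun_support[OF assms] by blast
  show ?thesis
  proof (rule test_funI)
    show "C_k k (dx f)" for k
      using test_fun_C_k[OF assms, of "Suc k"] by simp
    show "dx f z = 0" if "norm z > R" for z
      using that vanishing_near_imp_DERIV_0[of "\<lambda>t. (t, snd z)" R f "fst z"] R
      by (cases z) (simp add: dx_def continuous_on_Pair)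
  qed
qed

lemma test_fun_dy: assumes "test_fun f" shows "test_fun (dy f)"
proof -
  obtain R where R: "\<And>z. norm z > R \<Longrightarrow> f z = 0"
    using test_fun_support[OF assms] by blast
  show ?thesis
  proof (rule test_funI)
    show "C_k k (dy f)" for k
      using test_fun_C_k[OF assms, of "Suc k"] by simp
    show "dy f z = 0" if "norm z > R" for z
      using that vanishing_near_imp_DERIV_0[of "\<lambda>t. (fst z, t)" R f "snd z"] R
      by (cases z) (simp add: dy_def continuous_on_Pair)
  qed
qed

lemma test_fun_bounded:
  assumes "test_fun f"
  obtains C where "C \<ge> 0" "\<And>z. \<bar>f z\<bar> \<le> C"
proof -
  obtain R where R: "\<And>z. norm z > R \<Longrightarrow> f z = 0"
    using test_fun_support[OF assms] by blast
  have "bounded (f ` cball 0 R)"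
    using test_fun_continuous[OF assms] compact_cball
    by (intro compact_imp_bounded compact_continuous_image) (auto intro: continuous_on_subset)
  then obtain C where C: "\<And>z. z \<in> cball 0 R \<Longrightarrow> \<bar>f z\<bar> \<le> C"
    unfolding bounded_iff by (metis image_eqI real_norm_def)
  show thesis
  proof
    show "max C 0 \<ge> 0" by simp
    show "\<bar>f z\<bar> \<le> max C 0" for z
      using C[of z] R[of z] by (cases "norm z > R") (auto simp: max_def dist_norm)
  qed
qed

lemma test_fun_Linf:
  assumes "test_fun f"
  shows "Linf f"
  using Linf_continuous_bounded[OF test_fun_continuous[OF assms]] test_fun_bounded[OF assms] by blast

lemma test_fun_le_Linf_norm: "test_fun f \<Longrightarrow> \<bar>f z\<bar> \<le> Linf_norm f"
  by (intro continuous_le_Linf_norm test_fun_continuous test_fun_Linf)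

text \<open>
  One passes from one point to the other along a horizontal and a vertical segment and applies the
  mean value inequality on each.
\<close>

lemma test_fun_Lipschitz:
  assumes "test_fun f"
  shows "\<bar>f (x, y) - f (x', y')\<bar> \<le> Linf_norm (dx f) * \<bar>x - x'\<bar> + Linf_norm (dy f) * \<bar>y - y'\<bar>"
proof -
  have "norm (f (x, y) - f (x', y)) \<le> Linf_norm (dx f) * norm (x - x')"
    by (rule field_differentiable_bound[where S = UNIV and f' = "\<lambda>t. dx f (t, y)"])
       (use test_fun_has_dx[OF assms] test_fun_le_Linf_norm[OF test_fun_dx[OF assms]] in auto)
  moreover have "norm (f (x', y) - f (x', y')) \<le> Linf_norm (dy f) * norm (y - y')"
    by (rule field_differentiable_bound[where S = UNIV and f' = "\<lambda>t. dy f (x', t)"])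
       (use test_fun_has_dy[OF assms] test_fun_le_Linf_norm[OF test_fun_dy[OF assms]] in auto)
  ultimately show ?thesis by simp
qed

lemma deriv_translate: "deriv (\<lambda>t. f (t + c)) x = deriv f (x + c)" for f :: "real \<Rightarrow> real"
  unfolding deriv_def by (simp add: DERIV_shift)

lemma dx_translate: "dx (\<lambda>z. f (z + v)) = (\<lambda>z. dx f (z + v))"
  by (rule ext) (use deriv_translate[of "\<lambda>t. f (t, _ + snd v)" "fst v"] in \<open>auto simp: dx_def plus_prod_def\<close>)

lemma dy_translate: "dy (\<lambda>z. f (z + v)) = (\<lambda>z. dy f (z + v))"
  by (rule ext) (use deriv_translate[of "\<lambda>t. f (_ + fst v, t)" "snd v"] in \<open>auto simp: dy_def plus_prod_def\<close>)

lemma differentiable_translate: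
  "(\<lambda>t. f (t + c)) differentiable (at x) \<longleftrightarrow> f differentiable (at (x + c))" for f :: "real \<Rightarrow> real"
  by (metis DERIV_shift real_differentiable_def)

lemma C_k_translate: "C_k k f \<Longrightarrow> C_k k (\<lambda>z. f (z + v))"
proof (induction k arbitrary: f)
  case 0
  then show ?case
    by (auto intro!: continuous_on_compose2[of UNIV f] continuous_intros)
next
  case (Suc k)
  have "(\<lambda>t. f ((t, y) + v)) differentiable (at x)" for x y
    using Suc.prems differentiable_translate[of "\<lambda>t. f (t, y + snd v)" "fst v" x]
    by (simp add: plus_prod_def)
  moreover have "(\<lambda>t. f ((x, t) + v)) differentiable (at y)" for x y
    using Suc.prems differentiable_translate[of "\<lambda>t. f (x + fst v, t)" "snd v" y]
    by (simp add: plus_prod_def)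
  moreover have "continuous_on UNIV (\<lambda>z. f (z + v))"
    using Suc.prems by (auto intro!: continuous_on_compose2[of UNIV f] continuous_intros)
  ultimately show ?case
    using Suc.IH[of "dx f"] Suc.IH[of "dy f"] Suc.prems by (simp add: dx_translate dy_translate)
qed

lemma test_fun_translate:
  assumes "test_fun f"
  shows "test_fun (\<lambda>z. f (z + v))"
proof -
  obtain R where R: "\<And>z. norm z > R \<Longrightarrow> f z = 0"
    using test_fun_support[OF assms] by blast
  show ?thesis
  proof (rule test_funI)
    show "C_k k (\<lambda>z. f (z + v))" for k
      by (intro C_k_translate test_fun_C_k assms)
    show "f (z + v) = 0" if "norm z > R + norm v" for z
      using norm_diff_triangle_ineq[of z 0 0 v] norm_triangle_ineq4[of "z + v" v] that
      by (intro R) simp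
  qed
qed

section \<open>Smooth bump functions\<close>

text \<open>
  The functions \<open>t\<^sup>-\<^sup>m exp (- c / t)\<close>, continued by zero to \<open>t \<le> 0\<close>. The extra power makes the
  family closed under differentiation up to linear combinations, so that smoothness needs only
  first derivatives.
\<close>

definition flat :: "real \<Rightarrow> nat \<Rightarrow> real \<Rightarrow> real" where
  "flat c m t = (if t > 0 then inverse t ^ m * exp (- c / t) else 0)"

lemma flat_tendsto_0:
  assumes "c > 0"
  shows "(flat c m \<longlongrightarrow> 0) (at 0)"
proof -
  have "((\<lambda>t. inverse t ^ m * exp (- c / t)) \<longlongrightarrow> 0) (at_right 0)"
    using assms by real_asymp
  then have "(flat c m \<longlongrightarrow> 0) (at_right 0)"
    by (rule Lim_transform_eventually) (auto simp: flat_def eventually_at_filter)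
  moreover have "(flat c m \<longlongrightarrow> 0) (at_left 0)"
    by (rule tendsto_eventually) (auto simp: flat_def eventually_at_filter)
  ultimately show ?thesis by (simp add: filterlim_split_at)
qed

text \<open>
  Away from zero this is calculus. At zero the difference quotient of \<open>flat c m\<close> is
  \<open>flat c (m + 1)\<close>, which tends to zero, and this is also the value of the formula there.
\<close>

lemma flat_DERIV:
  assumes "c > 0"
  shows "(flat c m has_real_derivative c * flat c (m + 2) t - m * flat c (m + 1) t) (at t)"
proof (cases t "0::real" rule: linorder_cases)
  case less
  have d: "((\<lambda>t. 0) has_real_derivative c * flat c (m + 2) t - m * flat c (m + 1) t) (at t)"
    using less by (simp add: flat_def)
  have e: "\<forall>\<^sub>F x in nhds t. 0 = flat c m x"
    using less by (auto simp: flat_def eventually_nhds intro!: exI[of _ "{..<0}"])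
  show ?thesis
    using d by (rule DERIV_cong_ev[OF refl e refl, THEN iffD1])
next
  case equal
  have "((\<lambda>h. flat c (m + 1) h) \<longlongrightarrow> 0) (at 0)"
    by (rule flat_tendsto_0[OF assms])
  then have "((\<lambda>h. (flat c m (0 + h) - flat c m 0) / h) \<longlongrightarrow> 0) (at 0)"
    by (rule Lim_transform_eventually)
       (auto simp: flat_def eventually_at_filter field_simps)
  then show ?thesis
    using equal unfolding DERIV_def by (simp add: flat_def)
next
  case greater
  have d: "((\<lambda>t. inverse t ^ m * exp (- c / t)) has_real_derivative
      c * flat c (m + 2) t - m * flat c (m + 1) t) (at t)"
    using greater
    by (auto intro!: derivative_eq_intros simp: flat_def power2_eq_square divide_simps)
       (cases m; auto simp: field_simps power_inverse)
  have e: "\<forall>\<^sub>F x in nhds t. inverse x ^ m * exp (- c / x) = flat c m x"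
    using greater by (auto simp: flat_def eventually_nhds intro!: exI[of _ "{0<..}"])
  show ?thesis
    using d by (rule DERIV_cong_ev[OF refl e refl, THEN iffD1])
qed

lemma flat_continuous: "c > 0 \<Longrightarrow> continuous_on A (flat c m)"
  by (meson DERIV_continuous_on flat_DERIV has_field_derivative_at_within)

text \<open>
  A class of functions on the plane that contains the bump functions used below and is closed
  under both partial derivatives; \<open>C_k\<close> for all \<open>k\<close> then follows by induction on \<open>k\<close>, and the
  Leibniz rule for higher derivatives never has to be written down.
\<close>

inductive flat_algebra :: "(real \<times> real \<Rightarrow> real) \<Rightarrow> bool" where
  const: "flat_algebra (\<lambda>z. k)"
| of_fst: "c > 0 \<Longrightarrow> flat_algebra (\<lambda>z. flat c m (\<sigma> * fst z + a))"
| of_snd: "c > 0 \<Longrightarrow> flat_algebra (\<lambda>z. flat c m (\<sigma> * snd z + a))"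
| add: "flat_algebra f \<Longrightarrow> flat_algebra g \<Longrightarrow> flat_algebra (\<lambda>z. f z + g z)"
| mult: "flat_algebra f \<Longrightarrow> flat_algebra g \<Longrightarrow> flat_algebra (\<lambda>z. f z * g z)"

lemma flat_algebra_continuous: "flat_algebra f \<Longrightarrow> continuous_on UNIV f"
proof (induction rule: flat_algebra.induct)
  case (of_fst c m \<sigma> a)
  then show ?case
    by (intro continuous_on_compose2[OF flat_continuous[of c UNIV m]] continuous_intros) auto
next
  case (of_snd c m \<sigma> a)
  then show ?case
    by (intro continuous_on_compose2[OF flat_continuous[of c UNIV m]] continuous_intros) auto
qed (auto intro!: continuous_intros)

lemma flat_affine_DERIV:
  assumes "c > 0"
  shows "((\<lambda>t. flat c m (\<sigma> * t + a)) has_real_derivative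
    (\<sigma> * c) * flat c (m + 2) (\<sigma> * t + a) + (- \<sigma> * m) * flat c (m + 1) (\<sigma> * t + a)) (at t)"
proof -
  have "((\<lambda>t. \<sigma> * t + a) has_real_derivative \<sigma>) (at t)"
    by (auto intro!: derivative_eq_intros)
  from DERIV_chain2[OF flat_DERIV[OF assms] this] show ?thesis
    by (simp add: algebra_simps)
qed

lemma flat_algebra_DERIV:
  assumes "flat_algebra f"
  shows "\<exists>g. flat_algebra g \<and> (\<forall>x y. ((\<lambda>t. f (t, y)) has_real_derivative g (x, y)) (at x))"
    and "\<exists>g. flat_algebra g \<and> (\<forall>x y. ((\<lambda>t. f (x, t)) has_real_derivative g (x, y)) (at y))"
proof -
  show "\<exists>g. flat_algebra g \<and> (\<forall>x y. ((\<lambda>t. f (t, y)) has_real_derivative g (x, y)) (at x))"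
    using assms
  proof (induction rule: flat_algebra.induct)
    case (of_fst c m \<sigma> a)
    let ?g = "\<lambda>z. (\<sigma> * c) * flat c (m + 2) (\<sigma> * fst z + a)
            + (- \<sigma> * m) * flat c (m + 1) (\<sigma> * fst z + a)"
    have "flat_algebra ?g"
      by (intro flat_algebra.intros of_fst)
    moreover have "\<forall>x y. ((\<lambda>t. flat c m (\<sigma> * fst (t, y) + a)) has_real_derivative ?g (x, y)) (at x)"
      unfolding fst_conv snd_conv by (intro allI flat_affine_DERIV of_fst)
    ultimately show ?case by blast
  next
    case (add f g)
    then obtain f' g' where "flat_algebra f'" "flat_algebra g'"
      and "\<forall>x y. ((\<lambda>t. f (t, y)) has_real_derivative f' (x, y)) (at x)"
      and "\<forall>x y. ((\<lambda>t. g (t, y)) has_real_derivative g' (x, y)) (at x)" by blast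
    then show ?case
      by (intro exI[of _ "\<lambda>z. f' z + g' z"]) (auto intro!: flat_algebra.intros DERIV_add)
  next
    case (mult f g)
    then obtain f' g' where "flat_algebra f'" "flat_algebra g'"
      and "\<forall>x y. ((\<lambda>t. f (t, y)) has_real_derivative f' (x, y)) (at x)"
      and "\<forall>x y. ((\<lambda>t. g (t, y)) has_real_derivative g' (x, y)) (at x)" by blast
    then show ?case
      using mult.hyps
      by (intro exI[of _ "\<lambda>z. f z * g' z + f' z * g z"]) (auto intro!: flat_algebra.intros DERIV_mult')
  qed (auto intro!: exI[of _ "\<lambda>z. 0"] flat_algebra.const)
  show "\<exists>g. flat_algebra g \<and> (\<forall>x y. ((\<lambda>t. f (x, t)) has_real_derivative g (x, y)) (at y))"
    using assms
  proof (induction rule: flat_algebra.induct)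
    case (of_snd c m \<sigma> a)
    let ?g = "\<lambda>z. (\<sigma> * c) * flat c (m + 2) (\<sigma> * snd z + a)
            + (- \<sigma> * m) * flat c (m + 1) (\<sigma> * snd z + a)"
    have "flat_algebra ?g"
      by (intro flat_algebra.intros of_snd)
    moreover have "\<forall>x y. ((\<lambda>t. flat c m (\<sigma> * snd (x, t) + a)) has_real_derivative ?g (x, y)) (at y)"
      unfolding fst_conv snd_conv by (intro allI flat_affine_DERIV of_snd)
    ultimately show ?case by blast
  next
    case (add f g)
    then obtain f' g' where "flat_algebra f'" "flat_algebra g'"
      and "\<forall>x y. ((\<lambda>t. f (x, t)) has_real_derivative f' (x, y)) (at y)"
      and "\<forall>x y. ((\<lambda>t. g (x, t)) has_real_derivative g' (x, y)) (at y)" by blast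
    then show ?case
      by (intro exI[of _ "\<lambda>z. f' z + g' z"]) (auto intro!: flat_algebra.intros DERIV_add)
  next
    case (mult f g)
    then obtain f' g' where "flat_algebra f'" "flat_algebra g'"
      and "\<forall>x y. ((\<lambda>t. f (x, t)) has_real_derivative f' (x, y)) (at y)"
      and "\<forall>x y. ((\<lambda>t. g (x, t)) has_real_derivative g' (x, y)) (at y)" by blast
    then show ?case
      using mult.hyps
      by (intro exI[of _ "\<lambda>z. f z * g' z + f' z * g z"]) (auto intro!: flat_algebra.intros DERIV_mult')
  qed (auto intro!: exI[of _ "\<lambda>z. 0"] flat_algebra.const)
qed

lemma flat_algebra_C_k: "flat_algebra f \<Longrightarrow> C_k k f"
proof (induction k arbitrary: f)
  case 0
  then show ?case by (simp add: flat_algebra_continuous)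
next
  case (Suc k)
  obtain g where g: "flat_algebra g"
    "\<And>x y. ((\<lambda>t. f (t, y)) has_real_derivative g (x, y)) (at x)"
    using flat_algebra_DERIV(1)[OF Suc.prems] by blast
  obtain h where h: "flat_algebra h"
    "\<And>x y. ((\<lambda>t. f (x, t)) has_real_derivative h (x, y)) (at y)"
    using flat_algebra_DERIV(2)[OF Suc.prems] by blast
  have "dx f = g" "dy f = h"
    using DERIV_imp_deriv[OF g(2)] DERIV_imp_deriv[OF h(2)] by (auto simp: dx_def dy_def)
  then show ?case
    using g h Suc unfolding C_k.simps real_differentiable_def
    by (blast intro: flat_algebra_continuous)
qed

text \<open>
  A product of four functions \<open>exp (- c / t)\<close>, with \<open>t\<close> the distance to each side of the
  rectangle and \<open>c = 1 / (n + 1)\<close>. Since \<open>exp (- c / t) \<rightarrow> 1\<close> as \<open>c \<rightarrow> 0\<close> for every \<open>t > 0\<close>, letting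
  only \<open>c\<close> vary is enough to approximate the indicator of the open rectangle.
\<close>

definition box_bump :: "real \<times> real \<Rightarrow> real \<times> real \<Rightarrow> nat \<Rightarrow> real \<times> real \<Rightarrow> real" where
  "box_bump l u n z =
     (let c = inverse (real (Suc n)) in
      flat c 0 (fst z - fst l) * flat c 0 (fst u - fst z) * flat c 0 (snd z - snd l) * flat c 0 (snd u - snd z))"

lemma mem_box_prod: "z \<in> box l u \<longleftrightarrow> fst l < fst z \<and> fst z < fst u \<and> snd l < snd z \<and> snd z < snd u"
  for z l u :: "real \<times> real"
  by (cases z; cases l; cases u) (auto simp: box_def Basis_prod_def)

lemma box_bump_outside: "z \<notin> box l u \<Longrightarrow> box_bump l u n z = 0"
  unfolding mem_box_prod box_bump_def Let_def by (auto simp: flat_def)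

lemma flat_0_bounds: "c > 0 \<Longrightarrow> 0 \<le> flat c 0 t \<and> flat c 0 t \<le> 1"
  by (auto simp: flat_def)

lemma box_bump_bounds: "0 \<le> box_bump l u n z" "box_bump l u n z \<le> 1"
  unfolding box_bump_def Let_def by (auto intro!: mult_nonneg_nonneg mult_le_one simp: flat_0_bounds)

lemma flat_0_tendsto_1:
  assumes "t > 0"
  shows "(\<lambda>n. flat (inverse (real (Suc n))) 0 t) \<longlonglongrightarrow> 1"
proof -
  have "(\<lambda>n. exp (- inverse (real (Suc n)) / t)) \<longlonglongrightarrow> exp (- 0 / t)"
    using assms by (intro tendsto_intros LIMSEQ_inverse_real_of_nat) auto
  then show ?thesis using assms by (simp add: flat_def)
qed

lemma box_bump_tendsto_indicator: "(\<lambda>n. box_bump l u n z) \<longlonglongrightarrow> indicator (box l u) z"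
proof (cases "z \<in> box l u")
  case True
  then have "(\<lambda>n. box_bump l u n z) \<longlonglongrightarrow> 1 * 1 * 1 * 1"
    unfolding box_bump_def Let_def mem_box_prod by (intro tendsto_mult flat_0_tendsto_1) auto
  with True show ?thesis by simp
next
  case False
  then show ?thesis by (simp add: box_bump_outside)
qed

lemma box_bump_test_fun: "test_fun (box_bump l u n)"
proof -
  obtain R where R: "\<And>z. z \<in> box l u \<Longrightarrow> norm z \<le> R"
    using bounded_box[of l u] unfolding bounded_iff by blast
  let ?c = "inverse (real (Suc n))"
  have "flat_algebra (\<lambda>z. flat ?c 0 (1 * fst z + (- fst l)) * flat ?c 0 ((-1) * fst z + fst u)
      * flat ?c 0 (1 * snd z + (- snd l)) * flat ?c 0 ((-1) * snd z + snd u))"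
    by (intro flat_algebra.intros) auto
  moreover have "box_bump l u n = (\<lambda>z. flat ?c 0 (1 * fst z + (- fst l)) * flat ?c 0 ((-1) * fst z + fst u)
      * flat ?c 0 (1 * snd z + (- snd l)) * flat ?c 0 ((-1) * snd z + snd u))"
    by (simp add: box_bump_def Let_def fun_eq_iff)
  ultimately have "C_k k (box_bump l u n)" for k
    by (simp add: flat_algebra_C_k)
  then show ?thesis
    using R box_bump_outside[of _ l u n] by (intro test_funI[of _ R]) (meson not_less)+
qed

text \<open>
  Approximating indicators of rectangles by bumps shows that \<open>f\<close> has integral zero over every
  rectangle. If \<open>K > \<bar>f\<bar>\<close>, the measure with density \<open>1 + f / K\<close> is therefore a positive measure
  that agrees with Lebesgue measure on rectangles. It is Lebesgue measure, and densities are
  unique almost everywhere.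
\<close>

lemma fundamental_lemma_bounded:
  fixes f :: "real \<times> real \<Rightarrow> real"
  assumes [measurable]: "f \<in> borel_measurable borel"
    and bd: "\<And>z. \<bar>f z\<bar> \<le> C"
    and orth: "\<And>\<psi>. test_fun \<psi> \<Longrightarrow> (LINT z|lborel. f z * \<psi> z) = 0"
  shows "AE z in lborel. f z = 0"
proof -
  define K where "K = C + 1"
  have C: "C \<ge> 0" using bd[of 0] by simp
  then have K: "K > 0" by (simp add: K_def)
  have i1: "integrable lborel (\<lambda>z. indicator (box l u) z :: real)" for l u :: "real \<times> real"
    using emeasure_bounded_finite[OF bounded_box, of l u] by (intro integrable_real_indicator) auto
  have box0: "(LINT z|lborel. f z * indicator (box l u) z) = 0" for l u
  proof -
    have fin: "integrable lborel (\<lambda>z. C * indicator (box l u) z :: real)"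
      by (intro integrable_mult_right i1)
    have bump_m [measurable]: "box_bump l u n \<in> borel_measurable borel" for n
      by (intro borel_measurable_continuous_onI test_fun_continuous box_bump_test_fun)
    have "(\<lambda>n. LINT z|lborel. f z * box_bump l u n z)
        \<longlonglongrightarrow> (LINT z|lborel. f z * indicator (box l u) z)"
    proof (rule integral_dominated_convergence[where w = "\<lambda>z. C * indicator (box l u) z"])
      show "AE z in lborel. (\<lambda>n. f z * box_bump l u n z) \<longlonglongrightarrow> f z * indicator (box l u) z"
        by (intro AE_I2 tendsto_intros box_bump_tendsto_indicator)
      show "AE z in lborel. norm (f z * box_bump l u n z) \<le> C * indicator (box l u) z" for n
      proof (intro AE_I2)
        fix z
        have "\<bar>box_bump l u n z\<bar> \<le> indicator (box l u) z"
          using box_bump_bounds[of l u n z] box_bump_outside[of z l u n]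
          by (cases "z \<in> box l u") auto
        then show "norm (f z * box_bump l u n z) \<le> C * indicator (box l u) z"
          using bd[of z] C unfolding real_norm_def abs_mult by (intro mult_mono) auto
      qed
    qed (use fin in auto)
    moreover have "(\<lambda>n. LINT z|lborel. f z * box_bump l u n z) = (\<lambda>n. 0)"
      by (intro ext orth box_bump_test_fun)
    ultimately show ?thesis
      by (metis LIMSEQ_unique tendsto_const)
  qed
  define M where "M = density lborel (\<lambda>z. ennreal (1 + f z / K))"
  have pos: "0 \<le> 1 + f z / K" for z
  proof -
    have "\<bar>f z\<bar> \<le> K" using bd[of z] by (simp add: K_def)
    then show ?thesis using K by (simp add: field_simps)
  qed
  have "lborel = M"
  proof (rule lborel_eqI)
    fix l u :: "real \<times> real"
    assume lu: "\<And>b. b \<in> Basis \<Longrightarrow> l \<bullet> b \<le> u \<bullet> b"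
    have i2: "integrable lborel (\<lambda>z. f z * indicator (box l u) z :: real)"
      by (rule Bochner_Integration.integrable_bound[OF integrable_mult_right[OF i1, of C]])
         (use bd C in \<open>auto simp: abs_mult split: split_indicator\<close>)
    have "emeasure M (box l u) = (\<integral>\<^sup>+z. ennreal ((1 + f z / K) * indicator (box l u) z) \<partial>lborel)"
      unfolding M_def by (subst emeasure_density) (auto intro!: nn_integral_cong split: split_indicator)
    also have "\<dots> = ennreal (LINT z|lborel. indicator (box l u) z + inverse K * (f z * indicator (box l u) z))"
    proof (subst nn_integral_eq_integral)
      have "(1 + f z / K) * indicator (box l u) z
          = indicator (box l u) z + inverse K * (f z * indicator (box l u) z)" for z
        by (simp add: algebra_simps divide_inverse)
      then show "integrable lborel (\<lambda>z. (1 + f z / K) * indicator (box l u) z)"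
        "ennreal (LINT z|lborel. (1 + f z / K) * indicator (box l u) z)
          = ennreal (LINT z|lborel. indicator (box l u) z + inverse K * (f z * indicator (box l u) z))"
        using i1 i2 by simp_all
    qed (use pos in simp)
    also have "(LINT z|lborel. indicator (box l u) z + inverse K * (f z * indicator (box l u) z))
        = measure lborel (box l u)"
      using i1 i2 box0 by simp
    also have "ennreal (measure lborel (box l u)) = (\<Prod>b\<in>Basis. (u - l) \<bullet> b)"
      using lu by (simp add: measure_def)
    finally show "emeasure M (box l u) = (\<Prod>b\<in>Basis. (u - l) \<bullet> b)" .
  qed (simp add: M_def)
  then have "density lborel (\<lambda>z. 1) = density lborel (\<lambda>z. ennreal (1 + f z / K))"
    by (simp add: M_def density_1)
  then have "AE z in lborel. 1 = ennreal (1 + f z / K)"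
    by (subst (asm) sigma_finite_measure.density_unique_iff[OF sigma_finite_lborel]) auto
  then show ?thesis
  proof eventually_elim
    case (elim z)
    then have "1 + f z / K = 1" by (metis ennreal_eq_1)
    then show ?case using K by simp
  qed
qed

section \<open>Bounded weak derivatives give Lipschitz continuity\<close>

lemma AE_lborel_translate:
  fixes v :: "'a::euclidean_space"
  assumes "AE z in lborel. P z"
  shows "AE z in lborel. P (z + v)"
proof -
  have "AE z in distr lborel borel ((+) v). P z"
    unfolding lborel_distr_plus by (rule assms)
  then have "AE z in lborel. P (v + z)"
    by (rule AE_distrD[rotated]) simp
  then show ?thesis by (simp add: add.commute)
qed

lemma lborel_integral_translate:
  fixes f :: "'a::euclidean_space \<Rightarrow> real"
  assumes [measurable]: "f \<in> borel_measurable borel"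
  shows "(LINT z|lborel. f (z + v)) = (LINT z|lborel. f z)"
proof -
  have "(LINT z|lborel. f z) = (LINT z|distr lborel borel ((+) v). f z)"
    by (simp add: lborel_distr_plus)
  also have "\<dots> = (LINT z|lborel. f (v + z))"
    by (rule integral_distr) auto
  finally show ?thesis by (simp add: add.commute)
qed

lemma integrable_bounded_support:
  fixes h :: "'a::euclidean_space \<Rightarrow> real"
  assumes "h \<in> borel_measurable borel" and "\<And>z. \<bar>h z\<bar> \<le> B" and "\<And>z. norm z > R \<Longrightarrow> h z = 0"
  shows "integrable lborel h"
proof (rule integrableI_bounded_set[where A = "cball 0 R"])
  show "AE z in lborel. z \<notin> cball 0 R \<longrightarrow> h z = 0"
    using assms(3) by (auto simp: dist_norm)
  show "emeasure lborel (cball 0 R :: 'a set) < \<infinity>"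
    by (rule emeasure_bounded_finite) simp
  show "AE z in lborel. z \<in> cball 0 R \<longrightarrow> norm (h z) \<le> B"
    using assms(2) by simp
qed (use assms(1) in auto)

lemma test_fun_borel: "test_fun \<psi> \<Longrightarrow> \<psi> \<in> borel_measurable borel"
  by (intro borel_measurable_continuous_onI test_fun_continuous)

lemma bounded_mult_test_fun_integrable:
  assumes [measurable]: "f \<in> borel_measurable borel" and "\<And>z. \<bar>f z\<bar> \<le> C" and \<psi>: "test_fun \<psi>"
  shows "integrable lborel (\<lambda>z. f z * \<psi> z)"
proof -
  note [measurable] = test_fun_borel[OF \<psi>]
  obtain R where R: "\<And>z. norm z > R \<Longrightarrow> \<psi> z = 0"
    using test_fun_support[OF \<psi>] by blast
  obtain B where B: "\<And>z. \<bar>\<psi> z\<bar> \<le> B"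
    using test_fun_bounded[OF \<psi>] by blast
  show ?thesis
  proof (rule integrable_bounded_support)
    show "\<bar>f z * \<psi> z\<bar> \<le> C * B" for z
      using assms(2)[of z] B[of z] unfolding abs_mult by (intro mult_mono) auto
  qed (use R in auto)
qed

text \<open>
  Here \<open>D\<close> is the operator of differentiation in the direction \<open>e\<close>, so that both partial
  derivatives are covered, and \<open>g\<close> is the weak derivative of \<open>f\<close> in that direction. The function
  \<open>V z\<close> is the integral of \<open>g\<close> along the segment from \<open>z\<close> to \<open>z + s e\<close>. Moving the translations
  onto the test function \<open>\<psi>\<close> gives
  \[ \int V \psi = \int_0^s\!\!\int g(z)\, \psi(z - r e)\,dz\,dr
     = - \int f(z) \int_0^s D\psi(z - r e)\,dr\,dz
     = \int f(z)\, (\psi(z - s e) - \psi(z))\,dz , \]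
  so \<open>f (z + s e) - f z - V z\<close> is orthogonal to all test functions, whereas \<open>\<bar>V\<bar> \<le> A s\<close>.
\<close>

lemma difference_quotient_bound:
  fixes f g :: "real \<times> real \<Rightarrow> real" and e :: "real \<times> real"
  assumes [measurable]: "f \<in> borel_measurable borel" "g \<in> borel_measurable borel"
    and f_bd: "\<And>z. \<bar>f z\<bar> \<le> C" and g_bd: "\<And>z. \<bar>g z\<bar> \<le> A"
    and weak: "\<And>\<psi>. test_fun \<psi> \<Longrightarrow> (LINT z|lborel. f z * D \<psi> z) = - (LINT z|lborel. g z * \<psi> z)"
    and D_deriv: "\<And>\<psi> z t. test_fun \<psi> \<Longrightarrow>
      ((\<lambda>t. \<psi> (z + t *\<^sub>R e)) has_real_derivative D \<psi> (z + t *\<^sub>R e)) (at t)"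
    and D_test: "\<And>\<psi>. test_fun \<psi> \<Longrightarrow> test_fun (D \<psi>)"
    and s: "s \<ge> 0"
  shows "AE z in lborel. \<bar>f (z + s *\<^sub>R e) - f z\<bar> \<le> A * s"
proof -
  define V where "V z = (LINT r|lborel. indicator {0..s} r * g (z + r *\<^sub>R e))" for z
  have [measurable]: "V \<in> borel_measurable borel"
    unfolding V_def by measurable
  have V_bd: "\<bar>V z\<bar> \<le> A * s" for z
  proof -
    have ind: "integrable lborel (\<lambda>r. A * indicator {0..s} r)"
      using emeasure_bounded_finite[OF bounded_closed_interval, of 0 s]
      by (intro integrable_mult_right integrable_real_indicator) auto
    have "\<bar>V z\<bar> \<le> (LINT r|lborel. A * indicator {0..s} r)"
      unfolding V_def
      by (rule integral_abs_bound[THEN order_trans, OF integral_mono_AE'[OF ind]])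
         (use g_bd order_trans[OF abs_ge_zero g_bd] in \<open>auto simp: abs_mult split: split_indicator\<close>)
    then show ?thesis using s by simp
  qed
  have "(LINT z|lborel. (f (z + s *\<^sub>R e) - f z - V z) * \<psi> z) = 0" if \<psi>: "test_fun \<psi>" for \<psi>
  proof -
    note [measurable] = test_fun_borel[OF \<psi>] test_fun_borel[OF D_test[OF \<psi>]]
    obtain R where R: "\<And>z. norm z > R \<Longrightarrow> \<psi> z = 0"
      using test_fun_support[OF \<psi>] by blast
    obtain R' where R': "\<And>z. norm z > R' \<Longrightarrow> D \<psi> z = 0"
      using test_fun_support[OF D_test[OF \<psi>]] by blast
    obtain B where B: "\<And>z. \<bar>\<psi> z\<bar> \<le> B"
      using test_fun_bounded[OF \<psi>] by blast
    obtain B' where B': "\<And>z. \<bar>D \<psi> z\<bar> \<le> B'"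
      using test_fun_bounded[OF D_test[OF \<psi>]] by blast
    have pos: "C \<ge> 0" "A \<ge> 0" "B \<ge> 0" "B' \<ge> 0"
      using order_trans[OF abs_ge_zero f_bd] order_trans[OF abs_ge_zero g_bd]
        order_trans[OF abs_ge_zero B] order_trans[OF abs_ge_zero B'] by auto
    \<comment> \<open>Differentiation commutes with translation since the derivative is unique.\<close>
    have D_shift: "D (\<lambda>z. \<psi> (z + v)) z = D \<psi> (z + v)" for v z
      using DERIV_unique[OF D_deriv[OF test_fun_translate[OF \<psi>, of v], of z 0]] D_deriv[OF \<psi>, of "z + v" 0]
      by (simp add: ac_simps)
    have i1: "integrable lborel (\<lambda>z. f (z + s *\<^sub>R e) * \<psi> z)"
      by (rule bounded_mult_test_fun_integrable[OF _ f_bd \<psi>]) measurable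
    have i2: "integrable lborel (\<lambda>z. f z * \<psi> z)"
      by (rule bounded_mult_test_fun_integrable[OF _ f_bd \<psi>]) measurable
    have i3: "integrable lborel (\<lambda>z. V z * \<psi> z)"
      by (rule bounded_mult_test_fun_integrable[OF _ V_bd \<psi>]) measurable
    have i4: "integrable lborel (\<lambda>z. f z * \<psi> (z + (- s) *\<^sub>R e))"
      by (rule bounded_mult_test_fun_integrable[OF _ f_bd test_fun_translate[OF \<psi>]]) measurable
    have fub1: "integrable (lborel \<Otimes>\<^sub>M lborel)
        (\<lambda>(z, r). indicator {0..s} r * g (z + r *\<^sub>R e) * \<psi> z)"
      unfolding lborel_prod
    proof (rule integrable_bounded_support[where R = "R + s"])
      have "(\<lambda>(z, r). indicator {0..s} r * g (z + r *\<^sub>R e) * \<psi> z)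
          \<in> borel_measurable (borel \<Otimes>\<^sub>M borel)"
        by measurable
      then show "(\<lambda>(z, r). indicator {0..s} r * g (z + r *\<^sub>R e) * \<psi> z) \<in> borel_measurable borel"
        by (simp only: borel_prod)
      show "\<bar>case p of (z, r) \<Rightarrow> indicator {0..s} r * g (z + r *\<^sub>R e) * \<psi> z\<bar> \<le> 1 * A * B" for p
        unfolding case_prod_beta abs_mult using g_bd B pos
        by (intro mult_mono) (auto split: split_indicator)
      show "(case p of (z, r) \<Rightarrow> indicator {0..s} r * g (z + r *\<^sub>R e) * \<psi> z) = 0"
        if "norm p > R + s" for p
        using that norm_Pair_le[of "fst p" "snd p"] R[of "fst p"]
        by (cases "norm (fst p) > R") (auto simp: case_prod_beta split: split_indicator)
    qed
    have fub2: "integrable (lborel \<Otimes>\<^sub>M lborel)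
        (\<lambda>(z, r). f z * (D \<psi> (z + (- r) *\<^sub>R e) * indicator {0..s} r))"
      unfolding lborel_prod
    proof (rule integrable_bounded_support[where R = "R' + s * norm e + s"])
      have "(\<lambda>(z, r). f z * (D \<psi> (z + (- r) *\<^sub>R e) * indicator {0..s} r))
          \<in> borel_measurable (borel \<Otimes>\<^sub>M borel)"
        by measurable
      then show "(\<lambda>(z, r). f z * (D \<psi> (z + (- r) *\<^sub>R e) * indicator {0..s} r)) \<in> borel_measurable borel"
        by (simp only: borel_prod)
      show "\<bar>case p of (z, r) \<Rightarrow> f z * (D \<psi> (z + (- r) *\<^sub>R e) * indicator {0..s} r)\<bar> \<le> C * (B' * 1)" for p
        unfolding case_prod_beta abs_mult using f_bd B' pos
        by (intro mult_mono) (auto split: split_indicator)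
      show "(case p of (z, r) \<Rightarrow> f z * (D \<psi> (z + (- r) *\<^sub>R e) * indicator {0..s} r)) = 0"
        if p: "norm p > R' + s * norm e + s" for p
      proof (cases "snd p \<in> {0..s}")
        case True
        have "norm (snd p *\<^sub>R e) \<le> s * norm e"
          using True by (simp add: mult_right_mono)
        then have "norm (fst p + (- snd p) *\<^sub>R e) > R'"
          using p True norm_Pair_le[of "fst p" "snd p"] norm_triangle_ineq2[of "fst p" "snd p *\<^sub>R e"]
          by simp
        then show ?thesis by (simp add: case_prod_beta R')
      qed (simp add: case_prod_beta)
    qed
    \<comment> \<open>The primitive of \<open>D \<psi> (z - r e)\<close> in \<open>r\<close> is \<open>- \<psi> (z - r e)\<close>.\<close>
    have FTC: "(LINT r|lborel. D \<psi> (z + (- r) *\<^sub>R e) * indicator {0..s} r) = \<psi> z - \<psi> (z + (- s) *\<^sub>R e)" for z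
    proof -
      have "(LINT r|lborel. D \<psi> (z + (- r) *\<^sub>R e) * indicator {0..s} r)
          = - \<psi> (z + (- s) *\<^sub>R e) - - \<psi> (z + (- 0) *\<^sub>R e)"
      proof (rule integral_FTC_Icc_real[OF s])
        fix r
        have "((\<lambda>r. \<psi> (z + (- r) *\<^sub>R e)) has_real_derivative D \<psi> (z + (- r) *\<^sub>R e) * (- 1)) (at r)"
          by (rule DERIV_chain2[OF D_deriv[OF \<psi>]]) (auto intro!: derivative_eq_intros)
        from DERIV_minus[OF this]
        show "((\<lambda>r. - \<psi> (z + (- r) *\<^sub>R e)) has_real_derivative D \<psi> (z + (- r) *\<^sub>R e)) (at r)"
          by simp
        have "isCont (D \<psi>) (z + (- r) *\<^sub>R e)"
          using test_fun_continuous[OF D_test[OF \<psi>]] continuous_on_eq_continuous_at[OF open_UNIV]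
          by blast
        then show "isCont (\<lambda>r. D \<psi> (z + (- r) *\<^sub>R e)) r"
          by (intro isCont_o2[where f = "\<lambda>r. z + (- r) *\<^sub>R e" and g = "D \<psi>" and a = r] continuous_intros)
      qed
      then show ?thesis by simp
    qed
    have "(LINT z|lborel. V z * \<psi> z)
        = (LINT z|lborel. LINT r|lborel. indicator {0..s} r * g (z + r *\<^sub>R e) * \<psi> z)"
      unfolding V_def by (simp only: integral_mult_left_zero)
    also have "\<dots> = (LINT r|lborel. LINT z|lborel. indicator {0..s} r * g (z + r *\<^sub>R e) * \<psi> z)"
      using lborel_pair.Fubini_integral[OF fub1] by simp
    also have "\<dots> = (LINT r|lborel. LINT z|lborel. - (f z * (D \<psi> (z + (- r) *\<^sub>R e) * indicator {0..s} r)))"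
    proof (rule Bochner_Integration.integral_cong[OF refl])
      fix r
      have "(LINT z|lborel. g (z + r *\<^sub>R e) * \<psi> z) = (LINT z|lborel. g z * \<psi> (z + (- r) *\<^sub>R e))"
        using lborel_integral_translate[of "\<lambda>z. g z * \<psi> (z + (- r) *\<^sub>R e)" "r *\<^sub>R e"] by simp
      also have "\<dots> = - (LINT z|lborel. f z * D \<psi> (z + (- r) *\<^sub>R e))"
        using weak[OF test_fun_translate[OF \<psi>, of "(- r) *\<^sub>R e"]] unfolding D_shift by linarith
      finally have eq: "(LINT z|lborel. g (z + r *\<^sub>R e) * \<psi> z)
        = - (LINT z|lborel. f z * D \<psi> (z + (- r) *\<^sub>R e))" .
      show "(LINT z|lborel. indicator {0..s} r * g (z + r *\<^sub>R e) * \<psi> z)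
        = (LINT z|lborel. - (f z * (D \<psi> (z + (- r) *\<^sub>R e) * indicator {0..s} r)))"
        using eq by (cases "r \<in> {0..s}") simp_all
    qed
    also have "\<dots> = - (LINT z|lborel. LINT r|lborel. f z * (D \<psi> (z + (- r) *\<^sub>R e) * indicator {0..s} r))"
      using lborel_pair.Fubini_integral[OF fub2] by simp
    also have "\<dots> = - (LINT z|lborel. f z * (\<psi> z - \<psi> (z + (- s) *\<^sub>R e)))"
      by (simp only: integral_mult_right_zero FTC)
    also have "\<dots> = (LINT z|lborel. f z * \<psi> (z + (- s) *\<^sub>R e)) - (LINT z|lborel. f z * \<psi> z)"
      using i2 i4 by (simp add: right_diff_distrib)
    finally have "(LINT z|lborel. V z * \<psi> z)
        = (LINT z|lborel. f z * \<psi> (z + (- s) *\<^sub>R e)) - (LINT z|lborel. f z * \<psi> z)" .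
    moreover have "(LINT z|lborel. f (z + s *\<^sub>R e) * \<psi> z) = (LINT z|lborel. f z * \<psi> (z + (- s) *\<^sub>R e))"
      using lborel_integral_translate[of "\<lambda>z. f z * \<psi> (z + (- s) *\<^sub>R e)" "s *\<^sub>R e"] by simp
    ultimately show ?thesis
      using i1 i2 i3 by (simp add: left_diff_distrib)
  qed
  moreover have "\<bar>f (z + s *\<^sub>R e) - f z - V z\<bar> \<le> C + C + A * s" for z
    using f_bd[of z] f_bd[of "z + s *\<^sub>R e"] V_bd[of z] by linarith
  ultimately have "AE z in lborel. f (z + s *\<^sub>R e) - f z - V z = 0"
    by (intro fundamental_lemma_bounded) auto
  then show ?thesis
    by eventually_elim (use V_bd in \<open>simp add: algebra_simps\<close>)
qed

text \<open>
  Truncating at the essential bound makes the bound hold everywhere, and Borel measurability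
  allows composition with translations and the use of Fubini's theorem on product spaces.
\<close>

lemma Linf_borel_representative:
  assumes "Linf f"
  obtains g where "g \<in> borel_measurable borel" "\<And>z. \<bar>g z\<bar> \<le> Linf_norm f" "AE z in lborel. f z = g z"
proof -
  obtain g where g: "g \<in> borel_measurable lborel" "AE z in lborel. f z = g z"
    using completion_ex_borel_measurable_real[of f lborel] assms by (auto simp: Linf_def)
  let ?M = "Linf_norm f"
  have M: "?M \<ge> 0" by (rule Linf_norm_nonneg[OF assms])
  show thesis
  proof
    show "(\<lambda>z. max (- ?M) (min ?M (g z))) \<in> borel_measurable borel"
      using g(1) by measurable
    show "\<bar>max (- ?M) (min ?M (g z))\<bar> \<le> ?M" for z
      using M by auto
    have "AE z in lborel. \<bar>f z\<bar> \<le> ?M"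
      using Linf_AE_bound[OF assms] by (simp add: AE_completion_iff)
    with g(2) show "AE z in lborel. f z = max (- ?M) (min ?M (g z))"
      by eventually_elim auto
  qed
qed

lemma (in complete_measure) measurable_cong_AE:
  assumes f: "f \<in> measurable M N" and g: "g \<in> space M \<rightarrow> space N" and eq: "AE x in M. f x = g x"
  shows "g \<in> measurable M N"
proof (rule measurableI)
  fix A assume "A \<in> sets N"
  then have sets: "f -` A \<inter> space M \<in> sets M" using f by (rule measurable_sets[rotated])
  have ae: "AE x in M. x \<in> f -` A \<inter> space M \<longleftrightarrow> x \<in> g -` A \<inter> space M"
    using eq by eventually_elim auto
  show "g -` A \<inter> space M \<in> sets M"
    by (rule in_sets_AE[OF ae sets]) auto
qed (use g in auto)

lemma LINT_lebesgue_cong_borel: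
  fixes f g :: "'a::euclidean_space \<Rightarrow> real"
  assumes "AE z in lborel. f z = g z" and "g \<in> borel_measurable borel"
  shows "(LINT z|lebesgue. f z) = (LINT z|lborel. g z)"
proof -
  have g: "g \<in> borel_measurable lborel" using assms(2) by simp
  have eq: "AE z in lebesgue. g z = f z"
    using AE_completion[OF assms(1)] by eventually_elim simp
  then have "f \<in> borel_measurable lebesgue"
    using g by (intro completion.measurable_cong_AE[of g _ borel f]) (auto intro: measurable_completion)
  then have "(LINT z|lebesgue. g z) = (LINT z|lebesgue. f z)"
    using g eq by (intro integral_cong_AE) (auto intro: measurable_completion)
  moreover have "(LINT z|lebesgue. g z) = (LINT z|lborel. g z)" using g by (rule integral_completion)
  ultimately show ?thesis by simp
qed

lemma AE_difference_signed:
  fixes f :: "real \<times> real \<Rightarrow> real"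
  assumes "\<And>s. s \<ge> 0 \<Longrightarrow> AE z in lborel. \<bar>f (z + s *\<^sub>R e) - f z\<bar> \<le> A * s"
  shows "AE z in lborel. \<bar>f (z + s *\<^sub>R e) - f z\<bar> \<le> A * \<bar>s\<bar>"
proof (cases "s \<ge> 0")
  case True
  then show ?thesis using assms[of s] by simp
next
  case False
  then have "AE z in lborel. \<bar>f (z + (- s) *\<^sub>R e) - f z\<bar> \<le> A * (- s)"
    by (intro assms) auto
  from AE_lborel_translate[OF this, of "s *\<^sub>R e"] False show ?thesis
    by (simp add: abs_minus_commute)
qed

text \<open>
  The directional estimates hold for each fixed displacement \<open>v\<close> and almost every \<open>z\<close>, with an
  exceptional set that depends on \<open>v\<close>. Exchanging the quantifiers by Fubini's theorem gives, for
  almost every \<open>z\<close>, almost every \<open>v\<close>, and then almost every \<open>z' = z + v\<close>, which is what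
  averaging over \<open>z'\<close> requires.
\<close>

lemma weak_derivatives_AE_Lipschitz:
  assumes "Linf \<omega>" and wx: "weak_dx \<omega> \<omega>x" and wy: "weak_dy \<omega> \<omega>y" and "Linf \<omega>x" and "Linf \<omega>y"
  shows "AE z in lebesgue. AE z' in lebesgue.
    \<bar>\<omega> z' - \<omega> z\<bar> \<le> Linf_norm \<omega>x * \<bar>fst z' - fst z\<bar> + Linf_norm \<omega>y * \<bar>snd z' - snd z\<bar>"
proof -
  let ?A = "Linf_norm \<omega>x" and ?B = "Linf_norm \<omega>y"
  obtain f where f[measurable]: "f \<in> borel_measurable borel" and f_bd: "\<And>z. \<bar>f z\<bar> \<le> Linf_norm \<omega>"
    and f_eq: "AE z in lborel. \<omega> z = f z"
    using Linf_borel_representative[OF \<open>Linf \<omega>\<close>] by blast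
  obtain g where g[measurable]: "g \<in> borel_measurable borel" and g_bd: "\<And>z. \<bar>g z\<bar> \<le> ?A"
    and g_eq: "AE z in lborel. \<omega>x z = g z"
    using Linf_borel_representative[OF \<open>Linf \<omega>x\<close>] by blast
  obtain h where h[measurable]: "h \<in> borel_measurable borel" and h_bd: "\<And>z. \<bar>h z\<bar> \<le> ?B"
    and h_eq: "AE z in lborel. \<omega>y z = h z"
    using Linf_borel_representative[OF \<open>Linf \<omega>y\<close>] by blast
  have to_borel: "(LINT z|lebesgue. u z * \<psi> z) = (LINT z|lborel. v z * \<psi> z)"
    if "AE z in lborel. u z = v z" "v \<in> borel_measurable borel" "test_fun \<psi>" for u v \<psi>
  proof (rule LINT_lebesgue_cong_borel)
    show "AE z in lborel. u z * \<psi> z = v z * \<psi> z"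
      using that(1) by eventually_elim simp
    show "(\<lambda>z. v z * \<psi> z) \<in> borel_measurable borel"
      using that(2) test_fun_borel[OF that(3)] by measurable
  qed
  have horizontal: "AE z in lborel. \<bar>f (z + s *\<^sub>R (1, 0)) - f z\<bar> \<le> ?A * \<bar>s\<bar>" for s
  proof (rule AE_difference_signed, rule difference_quotient_bound[where D = dx, OF f g f_bd g_bd])
    fix \<psi> assume \<psi>: "test_fun \<psi>"
    show "(LINT z|lborel. f z * dx \<psi> z) = - (LINT z|lborel. g z * \<psi> z)"
      using wx \<psi> unfolding weak_dx_def
      by (simp only: to_borel[OF f_eq f test_fun_dx[OF \<psi>], symmetric] to_borel[OF g_eq g \<psi>, symmetric])
    show "((\<lambda>t. \<psi> (z + t *\<^sub>R (1, 0))) has_real_derivative dx \<psi> (z + t *\<^sub>R (1, 0))) (at t)" for z t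
      using test_fun_has_dx[OF \<psi>, of "snd z" "t + fst z", unfolded DERIV_shift]
      by (cases z) (simp add: add.commute)
  qed (auto intro: test_fun_dx)
  have vertical: "AE z in lborel. \<bar>f (z + s *\<^sub>R (0, 1)) - f z\<bar> \<le> ?B * \<bar>s\<bar>" for s
  proof (rule AE_difference_signed, rule difference_quotient_bound[where D = dy, OF f h f_bd h_bd])
    fix \<psi> assume \<psi>: "test_fun \<psi>"
    show "(LINT z|lborel. f z * dy \<psi> z) = - (LINT z|lborel. h z * \<psi> z)"
      using wy \<psi> unfolding weak_dy_def
      by (simp only: to_borel[OF f_eq f test_fun_dy[OF \<psi>], symmetric] to_borel[OF h_eq h \<psi>, symmetric])
    show "((\<lambda>t. \<psi> (z + t *\<^sub>R (0, 1))) has_real_derivative dy \<psi> (z + t *\<^sub>R (0, 1))) (at t)" for z t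
      using test_fun_has_dy[OF \<psi>, of "fst z" "t + snd z", unfolded DERIV_shift]
      by (cases z) (simp add: add.commute)
  qed (auto intro: test_fun_dy)
  have "AE z in lborel. \<bar>f (z + v) - f z\<bar> \<le> ?A * \<bar>fst v\<bar> + ?B * \<bar>snd v\<bar>" for v
    using AE_lborel_translate[OF horizontal[of "fst v"], of "snd v *\<^sub>R (0, 1)"] vertical[of "snd v"]
  proof eventually_elim
    case (elim z)
    have eq: "z + snd v *\<^sub>R (0, 1) + fst v *\<^sub>R (1, 0) = z + v"
      by (cases z; cases v) simp
    show ?case using elim unfolding eq by linarith
  qed
  then have "AE v in lborel. AE z in lborel. \<bar>f (z + v) - f z\<bar> \<le> ?A * \<bar>fst v\<bar> + ?B * \<bar>snd v\<bar>"
    by simp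
  moreover have [measurable]: "fst \<in> borel_measurable (borel :: (real \<times> real) measure)"
      "snd \<in> borel_measurable (borel :: (real \<times> real) measure)"
    by (intro borel_measurable_continuous_onI continuous_intros)+
  have "{p \<in> space (lborel \<Otimes>\<^sub>M lborel). \<bar>f (fst p + snd p) - f (fst p)\<bar>
      \<le> ?A * \<bar>fst (snd p)\<bar> + ?B * \<bar>snd (snd p)\<bar>} \<in> sets (lborel \<Otimes>\<^sub>M lborel)"
    by measurable
  moreover note lborel_pair.AE_commute[where P = "\<lambda>z v. \<bar>f (z + v) - f z\<bar> \<le> ?A * \<bar>fst v\<bar> + ?B * \<bar>snd v\<bar>", OF this]
  ultimately have "AE z in lborel. AE v in lborel. \<bar>f (z + v) - f z\<bar> \<le> ?A * \<bar>fst v\<bar> + ?B * \<bar>snd v\<bar>"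
    by simp
  then have "AE z in lborel. AE z' in lborel.
      \<bar>\<omega> z' - \<omega> z\<bar> \<le> ?A * \<bar>fst z' - fst z\<bar> + ?B * \<bar>snd z' - snd z\<bar>"
    using f_eq
  proof eventually_elim
    case (elim z)
    from AE_lborel_translate[OF elim(1), of "- z"] f_eq show ?case
      by eventually_elim (use elim(2) in simp)
  qed
  then show ?thesis by (simp add: AE_completion_iff)
qed

section \<open>Cells and cell averages\<close>

text \<open>
  Fubini's theorem for the completed measure: sections of a Lebesgue measurable function are
  measurable only almost everywhere, so the proof goes through a Borel function that agrees with
  \<open>f\<close> on almost every section almost everywhere.
\<close>

lemma iterated_integral_eq_rectangle:
  fixes f :: "real \<times> real \<Rightarrow> real"
  assumes f: "f \<in> borel_measurable lebesgue" and int: "set_integrable lebesgue (I \<times> J) f"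
    and [measurable]: "I \<in> sets borel" "J \<in> sets borel"
  shows "(LINT x:I|lebesgue. LINT y:J|lebesgue. f (x, y)) = (LINT z:I \<times> J|lebesgue. f z)"
proof -
  obtain g where g: "g \<in> borel_measurable lborel" and eq: "AE z in lborel. f z = g z"
    using completion_ex_borel_measurable_real[of f lborel] f by auto
  have [measurable]: "g \<in> borel_measurable borel" using g by simp
  define G where "G z = indicator (I \<times> J) z * g z" for z
  have IJ [measurable]: "I \<times> J \<in> sets borel"
    by (simp add: borel_prod[symmetric])
  have [measurable]: "G \<in> borel_measurable borel"
    unfolding G_def by measurable
  have eqG: "AE z in lborel. indicator (I \<times> J) z *\<^sub>R f z = G z"
    using eq unfolding G_def by eventually_elim simp
  have "integrable lebesgue G"
    using int unfolding set_integrable_def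
    by (rule integrable_cong_AE_imp[OF _ _ AE_completion[OF eqG]]) (simp add: measurable_completion)
  then have "integrable (lborel \<Otimes>\<^sub>M lborel) (\<lambda>(x, y). G (x, y))"
    by (simp add: lborel_prod integrable_completion)
  from lborel_pair.integral_fst[OF this]
  have fubini: "(LINT x|lborel. LINT y|lborel. G (x, y)) = (LINT z|lborel. G z)"
    by (simp add: lborel_prod)
  have "AE x in lborel. AE y in lborel. f (x, y) = g (x, y)"
    using lborel_pair.AE_pair[of "\<lambda>z. f z = g z"] eq unfolding lborel_prod by simp
  then have "AE x in lborel. indicator I x *\<^sub>R (LINT y:J|lebesgue. f (x, y)) = (LINT y|lborel. G (x, y))"
  proof eventually_elim
    case (elim x)
    have "(LINT y:J|lebesgue. f (x, y)) = (LINT y|lborel. indicator J y *\<^sub>R g (x, y))"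
      unfolding set_lebesgue_integral_def
    proof (rule LINT_lebesgue_cong_borel)
      show "AE y in lborel. indicator J y *\<^sub>R f (x, y) = indicator J y *\<^sub>R g (x, y)"
        using elim by eventually_elim simp
    qed measurable
    then show ?case by (cases "x \<in> I") (simp_all add: G_def indicator_times)
  qed
  then have "(LINT x:I|lebesgue. LINT y:J|lebesgue. f (x, y)) = (LINT x|lborel. LINT y|lborel. G (x, y))"
    unfolding set_lebesgue_integral_def by (rule LINT_lebesgue_cong_borel) measurable
  also have "\<dots> = (LINT z:I \<times> J|lebesgue. f z)"
    unfolding fubini set_lebesgue_integral_def using LINT_lebesgue_cong_borel[OF eqG] by simp
  finally show ?thesis .
qed

lemma AE_closed_rectangle_iff_half_open:
  fixes a b c d :: real
  shows "AE z in lebesgue. z \<in> {a..b} \<times> {c..d} \<longleftrightarrow> z \<in> {a..<b} \<times> {c..<d}"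
proof -
  have "cbox (a, c) (b, d) - box (a, c) (b, d) \<in> null_sets lebesgue"
    using negligible_frontier_interval negligible_iff_null_sets by blast
  from AE_not_in[OF this] show ?thesis
    by eventually_elim (auto simp: mem_box_prod cbox_Pair_eq)
qed

text \<open>
  Half-open, so that the cells partition the half-open square and the approximations are
  constant on each of them.
\<close>

definition cell :: "real \<Rightarrow> nat \<Rightarrow> nat \<Rightarrow> nat \<Rightarrow> (real \<times> real) set" where
  "cell L N i j = {grid L N i..<grid L N (Suc i)} \<times> {grid L N j..<grid L N (Suc j)}"

lemma borel_rectangle: "A \<in> sets borel \<Longrightarrow> B \<in> sets borel \<Longrightarrow> A \<times> B \<in> sets borel"
  for A B :: "real set"
  by (simp add: borel_prod[symmetric])

lemma cell_borel: "cell L N i j \<in> sets borel"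
  unfolding cell_def by (intro borel_rectangle) auto

lemma cell_lebesgue [measurable]: "cell L N i j \<in> sets lebesgue"
  using cell_borel by (simp add: sets_completionI_sets)

lemma grid_Suc: "grid L N (Suc i) = grid L N i + 2 * L / real N"
  unfolding grid_def by (simp add: algebra_simps add_divide_distrib)

lemma emeasure_cell:
  assumes "L > 0"
  shows "emeasure lebesgue (cell L N i j) = ennreal ((2 * L / real N)\<^sup>2)"
proof -
  have "emeasure lebesgue (cell L N i j) = emeasure (lborel \<Otimes>\<^sub>M lborel) (cell L N i j)"
    using cell_borel[of L N i j] by (simp add: lborel_prod)
  also have "\<dots> = ennreal (2 * L / real N) * ennreal (2 * L / real N)"
    unfolding cell_def using assms by (subst lborel.emeasure_pair_measure_Times) (auto simp: grid_Suc)
  also have "\<dots> = ennreal ((2 * L / real N)\<^sup>2)"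
    using assms by (simp add: ennreal_mult'[symmetric] power2_eq_square)
  finally show ?thesis .
qed

lemma measure_cell: "L > 0 \<Longrightarrow> measure lebesgue (cell L N i j) = (2 * L / real N)\<^sup>2"
  by (rule measure_eq_emeasure_eq_ennreal[OF _ emeasure_cell]) simp_all

lemma cell_avg_eq:
  assumes L: "L > 0" "N \<ge> 1" and f: "f \<in> borel_measurable lebesgue"
    and int: "set_integrable lebesgue (cell L N i j) f"
  shows "cell_avg L N f i j = (LINT z:cell L N i j|lebesgue. f z) / (2 * L / real N)\<^sup>2"
proof -
  let ?I = "{grid L N i..grid L N (Suc i)}" and ?J = "{grid L N j..grid L N (Suc j)}"
  have ind: "AE z in lebesgue. indicator (cell L N i j) z *\<^sub>R f z = indicator (?I \<times> ?J) z *\<^sub>R f z"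
    using AE_closed_rectangle_iff_half_open[of "grid L N i" "grid L N (Suc i)" "grid L N j" "grid L N (Suc j)"]
    by eventually_elim (auto simp: cell_def split: split_indicator)
  have IJ [measurable]: "?I \<times> ?J \<in> sets lebesgue"
    using borel_rectangle[of ?I ?J] by (simp add: sets_completionI_sets)
  note f [measurable]
  have "set_integrable lebesgue (?I \<times> ?J) f"
    using int unfolding set_integrable_def by (rule integrable_cong_AE_imp[OF _ _ ind]) measurable
  then have "(LINT x:?I|lebesgue. LINT y:?J|lebesgue. f (x, y)) = (LINT z:?I \<times> ?J|lebesgue. f z)"
    using f by (intro iterated_integral_eq_rectangle) auto
  also have "\<dots> = (LINT z:cell L N i j|lebesgue. f z)"
    unfolding set_lebesgue_integral_def by (rule integral_cong_AE[OF _ _ ind, symmetric]) measurable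
  finally show ?thesis
    unfolding cell_avg_def by (simp add: power_divide power_mult_distrib)
qed

lemma sum_indicator_consecutive_intervals:
  fixes g :: "nat \<Rightarrow> real"
  assumes "\<And>i. g i \<le> g (Suc i)"
  shows "(\<Sum>i<n. indicator {g i..<g (Suc i)} x) = (indicator {g 0..<g n} x :: real)"
proof (induction n)
  case (Suc n)
  have "g 0 \<le> g n" using lift_Suc_mono_le[of g] assms by simp
  then show ?case
    using Suc assms[of n] by (auto simp: indicator_def)
qed simp

lemma sum_indicator_cell:
  assumes "L > 0" "N \<ge> 1"
  shows "(\<Sum>i<N. \<Sum>j<N. indicator (cell L N i j) z) = (indicator ({-L..<L} \<times> {-L..<L}) z :: real)"
proof -
  have "grid L N 0 = - L" "grid L N N = L"
    using assms by (auto simp: grid_def)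
  moreover have "grid L N i \<le> grid L N (Suc i)" for i
    using assms by (simp add: grid_Suc)
  ultimately have sum1: "(\<Sum>i<N. indicator {grid L N i..<grid L N (Suc i)} x) = (indicator {-L..<L} x :: real)" for x
    using sum_indicator_consecutive_intervals[where g = "grid L N" and n = N and x = x] by simp
  have "(\<Sum>i<N. \<Sum>j<N. indicator (cell L N i j) z) =
     (\<Sum>i<N. \<Sum>j<N. indicator {grid L N i..<grid L N (Suc i)} (fst z)
        * (indicator {grid L N j..<grid L N (Suc j)} (snd z) :: real))"
    by (simp only: cell_def indicator_times)
  also have "\<dots> = indicator ({-L..<L} \<times> {-L..<L}) z"
    by (simp only: sum_product[symmetric] sum1 indicator_times)
  finally show ?thesis .
qed

text \<open>
  Subtracting \<open>w k (a - \<rho>)\<close>, whose integral vanishes because \<open>a\<close> is the mean of \<open>\<rho>\<close>, leaves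
  \<open>w (\<phi> - k) (a - \<rho>) + (w - \<omega>) \<phi> \<rho>\<close>. Here \<open>\<bar>a - \<rho>\<bar> \<le> a + \<rho>\<close>, and the total mass of \<open>a\<close> is that
  of \<open>\<rho>\<close>, hence at most \<open>P\<close> times the measure of the space.
\<close>

lemma (in finite_measure) average_replacement_error:
  fixes \<rho> \<omega> \<phi> :: "'a \<Rightarrow> real"
  assumes \<rho>: "integrable M \<rho>" and \<rho>_bd: "AE z in M. 0 \<le> \<rho> z \<and> \<rho> z \<le> P"
    and \<omega> [measurable]: "\<omega> \<in> borel_measurable M" and \<omega>_bd: "AE z in M. \<bar>\<omega> z\<bar> \<le> S"
    and \<phi> [measurable]: "\<phi> \<in> borel_measurable M" and \<phi>_bd: "\<And>z. \<bar>\<phi> z\<bar> \<le> \<Phi>"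
    and \<phi>_osc: "AE z in M. \<bar>\<phi> z - k\<bar> \<le> d"
    and w: "\<bar>w\<bar> \<le> S" and \<omega>_osc: "AE z in M. \<bar>w - \<omega> z\<bar> \<le> \<kappa>"
    and a: "a \<ge> 0" "a * measure M (space M) = (LINT z|M. \<rho> z)"
    and d: "d \<ge> 0"
  shows "integrable M (\<lambda>z. a * w * \<phi> z - \<rho> z * \<omega> z * \<phi> z)"
    and "\<bar>LINT z|M. a * w * \<phi> z - \<rho> z * \<omega> z * \<phi> z\<bar>
      \<le> S * d * ((LINT z|M. \<rho> z) + P * measure M (space M)) + \<kappa> * \<Phi> * (LINT z|M. \<rho> z)"
proof -
  note [measurable] = borel_measurable_integrable[OF \<rho>]
  let ?m = "measure M (space M)"
  have S: "S \<ge> 0" using w by linarith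
  have \<Phi>: "\<Phi> \<ge> 0" using \<phi>_bd[of undefined] by linarith
  have "integrable M \<phi>"
    by (rule integrable_const_bound[where B = \<Phi>]) (use \<phi>_bd in auto)
  moreover have "integrable M (\<lambda>z. \<rho> z * \<omega> z * \<phi> z)"
  proof (rule Bochner_Integration.integrable_bound[OF integrable_mult_right[OF \<rho>, of "S * \<Phi>"]])
    show "AE z in M. norm (\<rho> z * \<omega> z * \<phi> z) \<le> norm (S * \<Phi> * \<rho> z)"
      using \<omega>_bd
    proof eventually_elim
      case (elim z)
      then have "\<bar>\<rho> z\<bar> * (\<bar>\<omega> z\<bar> * \<bar>\<phi> z\<bar>) \<le> \<bar>\<rho> z\<bar> * (S * \<Phi>)"
        using \<phi>_bd[of z] S by (intro mult_mono) auto
      then show ?case using S \<Phi> by (simp add: abs_mult ac_simps)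
    qed
  qed measurable
  ultimately show int: "integrable M (\<lambda>z. a * w * \<phi> z - \<rho> z * \<omega> z * \<phi> z)"
    by simp
  have int_a\<rho>: "integrable M (\<lambda>z. a - \<rho> z)" using \<rho> by simp
  have mean0: "(LINT z|M. w * k * (a - \<rho> z)) = 0"
    using \<rho> a by (simp add: mult.commute)
  have centred: "(LINT z|M. a * w * \<phi> z - \<rho> z * \<omega> z * \<phi> z)
      = (LINT z|M. (a * w * \<phi> z - \<rho> z * \<omega> z * \<phi> z) - w * k * (a - \<rho> z))"
    using int int_a\<rho> mean0 by simp
  have "\<bar>LINT z|M. a * w * \<phi> z - \<rho> z * \<omega> z * \<phi> z\<bar>
      \<le> (LINT z|M. S * d * (a + \<rho> z) + \<kappa> * \<Phi> * \<rho> z)"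
    unfolding centred
  proof (rule order_trans[OF integral_abs_bound integral_mono_AE])
    show "integrable M (\<lambda>z. \<bar>(a * w * \<phi> z - \<rho> z * \<omega> z * \<phi> z) - w * k * (a - \<rho> z)\<bar>)"
      using int int_a\<rho> by simp
    show "integrable M (\<lambda>z. S * d * (a + \<rho> z) + \<kappa> * \<Phi> * \<rho> z)"
      using \<rho> by simp
    show "AE z in M. \<bar>(a * w * \<phi> z - \<rho> z * \<omega> z * \<phi> z) - w * k * (a - \<rho> z)\<bar>
        \<le> S * d * (a + \<rho> z) + \<kappa> * \<Phi> * \<rho> z"
      using \<rho>_bd \<omega>_osc \<phi>_osc
    proof eventually_elim
      case (elim z)
      have "(a * w * \<phi> z - \<rho> z * \<omega> z * \<phi> z) - w * k * (a - \<rho> z)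
          = w * (\<phi> z - k) * (a - \<rho> z) + (w - \<omega> z) * \<phi> z * \<rho> z"
        by (simp add: algebra_simps)
      also have "\<bar>\<dots>\<bar> \<le> \<bar>w\<bar> * \<bar>\<phi> z - k\<bar> * \<bar>a - \<rho> z\<bar> + \<bar>w - \<omega> z\<bar> * \<bar>\<phi> z\<bar> * \<bar>\<rho> z\<bar>"
        by (rule order_trans[OF abs_triangle_ineq]) (simp add: abs_mult)
      also have "\<dots> \<le> S * d * (a + \<rho> z) + \<kappa> * \<Phi> * \<rho> z"
        using elim w \<phi>_bd[of z] a d S by (intro add_mono mult_mono) auto
      finally show ?case .
    qed
  qed
  also have "\<dots> = S * d * ((LINT z|M. \<rho> z) + a * ?m) + \<kappa> * \<Phi> * (LINT z|M. \<rho> z)"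
    using \<rho> by (simp add: algebra_simps)
  also have "\<dots> \<le> S * d * ((LINT z|M. \<rho> z) + P * ?m) + \<kappa> * \<Phi> * (LINT z|M. \<rho> z)"
  proof -
    have "(LINT z|M. \<rho> z) \<le> (LINT z|M. P)"
      using \<rho> \<rho>_bd by (intro integral_mono_AE) auto
    then have "a * ?m \<le> P * ?m" using a by (simp add: mult.commute)
    then show ?thesis using S d by (intro add_right_mono mult_left_mono add_left_mono) auto
  qed
  finally show "\<bar>LINT z|M. a * w * \<phi> z - \<rho> z * \<omega> z * \<phi> z\<bar>
      \<le> S * d * ((LINT z|M. \<rho> z) + P * ?m) + \<kappa> * \<Phi> * (LINT z|M. \<rho> z)" .
qed

lemma set_integrable_bounded_cell:
  fixes f :: "real \<times> real \<Rightarrow> real"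
  assumes "L > 0" and [measurable]: "f \<in> borel_measurable lebesgue" and "AE z in lebesgue. \<bar>f z\<bar> \<le> C"
  shows "set_integrable lebesgue (cell L N i j) f"
  unfolding set_integrable_def
  by (rule integrableI_bounded_set_indicator[where B = C])
     (use assms emeasure_cell[OF assms(1)] in auto)

lemma finite_measure_cell: "L > 0 \<Longrightarrow> finite_measure (lebesgue_on (cell L N i j))"
  by (rule finite_measureI)
     (simp add: emeasure_restrict_space space_restrict_space emeasure_cell del: emeasure_completion)

lemma AE_lebesgue_on_cell:
  "(AE z in lebesgue_on (cell L N i j). P z) \<longleftrightarrow> (AE z in lebesgue. z \<in> cell L N i j \<longrightarrow> P z)"
  by (simp add: AE_restrict_space_iff)

lemma LINT_lebesgue_on_cell:
  "(LINT z|lebesgue_on (cell L N i j). f z) = (LINT z:cell L N i j|lebesgue. f z)" for f :: "_ \<Rightarrow> real"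
  by (simp add: integral_restrict_space set_lebesgue_integral_def)

lemma integrable_lebesgue_on_cell:
  "integrable (lebesgue_on (cell L N i j)) f \<longleftrightarrow> set_integrable lebesgue (cell L N i j) f" for f :: "_ \<Rightarrow> real"
  by (simp add: integrable_restrict_space set_integrable_def)

lemma measure_lebesgue_on_cell:
  "L > 0 \<Longrightarrow> measure (lebesgue_on (cell L N i j)) (cell L N i j) = (2 * L / real N)\<^sup>2"
  by (simp add: measure_restrict_space space_restrict_space measure_cell del: measure_completion)

lemma cell_width: "z \<in> cell L N i j \<Longrightarrow> z' \<in> cell L N i j \<Longrightarrow>
    \<bar>fst z - fst z'\<bar> \<le> 2 * L / real N \<and> \<bar>snd z - snd z'\<bar> \<le> 2 * L / real N"
  by (auto simp: cell_def grid_Suc)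

text \<open>
  An average deviates from \<open>k\<close> no more than the function does. With \<open>k\<close> a value of \<open>f\<close> this
  bounds the error of replacing \<open>f\<close> by its average, and with \<open>k = 0\<close> it bounds the average.
\<close>

lemma cell_avg_sub_le:
  assumes L: "L > 0" "N \<ge> 1" and f: "set_integrable lebesgue (cell L N i j) f" "f \<in> borel_measurable lebesgue"
    and le: "AE z in lebesgue. z \<in> cell L N i j \<longrightarrow> \<bar>f z - k\<bar> \<le> C"
  shows "\<bar>cell_avg L N f i j - k\<bar> \<le> C"
proof -
  interpret finite_measure "lebesgue_on (cell L N i j)"
    by (rule finite_measure_cell) fact
  let ?M = "lebesgue_on (cell L N i j)" and ?m = "(2 * L / real N)\<^sup>2"
  have m: "?m > 0" using L by simp
  have int: "integrable ?M f" using f by (simp add: integrable_lebesgue_on_cell)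
  have "cell_avg L N f i j * ?m = (LINT z|?M. f z)"
    using cell_avg_eq[OF L f(2,1)] m by (simp add: LINT_lebesgue_on_cell)
  then have "(cell_avg L N f i j - k) * ?m = (LINT z|?M. f z - k)"
    using int by (simp add: measure_lebesgue_on_cell[OF L(1)] left_diff_distrib mult.commute)
  moreover have "\<bar>LINT z|?M. f z - k\<bar> \<le> (LINT z|?M. C)"
    by (rule order_trans[OF integral_abs_bound integral_mono_AE])
       (use int le in \<open>auto simp: AE_lebesgue_on_cell\<close>)
  ultimately have "\<bar>(cell_avg L N f i j - k) * ?m\<bar> \<le> C * ?m"
    by (simp add: measure_lebesgue_on_cell[OF L(1)] mult.commute)
  then have "\<bar>cell_avg L N f i j - k\<bar> * ?m \<le> C * ?m"
    using m by (simp only: abs_mult abs_of_pos)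
  then show ?thesis using m by (simp only: mult_le_cancel_right_pos)
qed

section \<open>The error of the piecewise constant approximation\<close>

text \<open>
  The error splits into the tail outside the square, which costs \<open>\<epsilon>\<close>, and the errors on the \<open>N\<^sup>2\<close>
  cells of side \<open>2 L / N\<close>. Summed over the cells, the masses \<open>\<integral> \<rho>\<close> give at most the \<open>L\<^sup>1\<close> norm of
  \<open>\<rho>\<close>, and the areas give \<open>4 L\<^sup>2\<close>.
\<close>

lemma weighted_grid_error:
  fixes \<rho> \<omega> \<phi> :: "real \<times> real \<Rightarrow> real" and w :: "nat \<Rightarrow> nat \<Rightarrow> real"
  assumes \<rho>: "integrable lebesgue \<rho>" "Linf \<rho>" "AE z in lebesgue. \<rho> z \<ge> 0"
    and L: "L > 0" "N \<ge> 1"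
    and tail: "(LINT z:(UNIV - {-L..L} \<times> {-L..L})|lebesgue. \<rho> z) \<le> \<epsilon>"
    and \<phi>: "test_fun \<phi>"
    and \<omega> [measurable]: "\<omega> \<in> borel_measurable lebesgue" and \<omega>_bd: "AE z in lebesgue. \<bar>\<omega> z\<bar> \<le> S"
    and w_bd: "\<And>i j. \<bar>w i j\<bar> \<le> S"
    and osc: "\<And>i j. AE z in lebesgue. z \<in> cell L N i j \<longrightarrow> \<bar>w i j - \<omega> z\<bar> \<le> \<kappa>"
  shows "\<bar>(LINT z|lebesgue. (\<Sum>i<N. \<Sum>j<N. cell_avg L N \<rho> i j * w i j * indicator (cell L N i j) z) * \<phi> z)
      - (LINT z|lebesgue. \<rho> z * \<omega> z * \<phi> z)\<bar>
    \<le> \<epsilon> * Linf_norm \<phi> * S + \<kappa> * Linf_norm \<phi> * L1_norm \<rho> + D_const L \<rho> \<phi> * S / real N"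
proof -
  let ?\<Phi> = "Linf_norm \<phi>" and ?P = "Linf_norm \<rho>" and ?h = "2 * L / real N"
  let ?Q = "{-L..<L} \<times> {-L..<L}" and ?C = "cell L N" and ?a = "cell_avg L N \<rho>"
  let ?G = "\<lambda>z. \<rho> z * \<omega> z * \<phi> z"
  let ?E = "\<lambda>i j z. ?a i j * w i j * \<phi> z - ?G z"
  define d where "d = (Linf_norm (dx \<phi>) + Linf_norm (dy \<phi>)) * ?h"
  have h: "?h > 0" using L by simp
  have nn: "Linf_norm (dx \<phi>) \<ge> 0" "Linf_norm (dy \<phi>) \<ge> 0" "?\<Phi> \<ge> 0" "?P \<ge> 0" "S \<ge> 0"
    using Linf_norm_nonneg[OF test_fun_Linf] test_fun_dx test_fun_dy \<phi> \<rho>(2) Linf_norm_nonneg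
      order_trans[OF abs_ge_zero w_bd] by auto
  have d: "d \<ge> 0"
    unfolding d_def by (rule mult_nonneg_nonneg[OF add_nonneg_nonneg[OF nn(1,2)] less_imp_le[OF h]])
  have \<phi>_bd: "\<bar>\<phi> z\<bar> \<le> ?\<Phi>" for z by (rule test_fun_le_Linf_norm[OF \<phi>])
  note [measurable] = continuous_imp_lebesgue_measurable[OF test_fun_continuous[OF \<phi>]]
    borel_measurable_integrable[OF \<rho>(1)]
  have Q [measurable]: "?Q \<in> sets lebesgue" "{-L..L} \<times> {-L..L} \<in> sets lebesgue"
    using borel_rectangle[of "{-L..<L}" "{-L..<L}"] borel_rectangle[of "{-L..L}" "{-L..L}"]
    by (auto simp: sets_completionI_sets)
  have Qc [measurable]: "- ?Q \<in> sets lebesgue"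
    using sets.compl_sets[OF Q(1)] by (simp add: Compl_eq_Diff_UNIV)
  have \<rho>_on: "set_integrable lebesgue A \<rho>" if "A \<in> sets lebesgue" for A
    unfolding set_integrable_def by (rule integrable_mult_indicator[OF that \<rho>(1)])
  have G_le: "AE z in lebesgue. \<bar>?G z\<bar> \<le> S * ?\<Phi> * \<rho> z"
    using \<rho>(3) \<omega>_bd
  proof eventually_elim
    case (elim z)
    then have "\<rho> z * (\<bar>\<omega> z\<bar> * \<bar>\<phi> z\<bar>) \<le> \<rho> z * (S * ?\<Phi>)"
      using \<phi>_bd[of z] nn by (intro mult_left_mono mult_mono) auto
    then show ?case using elim by (simp add: abs_mult ac_simps)
  qed
  have G_int: "integrable lebesgue ?G"
    by (rule Bochner_Integration.integrable_bound[OF integrable_mult_right[OF \<rho>(1), of "S * ?\<Phi>"]])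
       (use G_le in \<open>auto elim!: eventually_mono\<close>)

  have cell_error: "set_integrable lebesgue (?C i j) (?E i j)"
      "\<bar>LINT z:?C i j|lebesgue. ?E i j z\<bar>
        \<le> S * d * ((LINT z:?C i j|lebesgue. \<rho> z) + ?P * ?h\<^sup>2) + \<kappa> * ?\<Phi> * (LINT z:?C i j|lebesgue. \<rho> z)"
    for i j
  proof -
    interpret finite_measure "lebesgue_on (?C i j)"
      by (rule finite_measure_cell) fact
    have a: "?a i j * ?h\<^sup>2 = (LINT z:?C i j|lebesgue. \<rho> z)"
      using cell_avg_eq[OF L borel_measurable_integrable[OF \<rho>(1)] \<rho>_on[OF cell_lebesgue], of i j]
      unfolding nonzero_eq_divide_eq[OF power_not_zero[OF less_imp_neq[OF h, symmetric]]] .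
    have "(LINT z:?C i j|lebesgue. \<rho> z) \<ge> 0"
      unfolding set_lebesgue_integral_def using \<rho>(3)
      by (intro integral_nonneg_AE) (auto elim!: eventually_mono)
    then have a_nn: "?a i j \<ge> 0"
      using a h by (metis zero_le_mult_iff not_less zero_less_power2 less_irrefl)
    have \<rho>_bd: "AE z in lebesgue_on (?C i j). 0 \<le> \<rho> z \<and> \<rho> z \<le> ?P"
      unfolding AE_lebesgue_on_cell using \<rho>(3) Linf_AE_bound[OF \<rho>(2)] by eventually_elim auto
    have \<phi>_osc: "\<bar>\<phi> z - \<phi> (grid L N i, grid L N j)\<bar> \<le> d" if "z \<in> space (lebesgue_on (?C i j))" for z
    proof -
      have z: "\<bar>fst z - grid L N i\<bar> \<le> ?h" "\<bar>snd z - grid L N j\<bar> \<le> ?h"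
        using that by (auto simp: cell_def grid_Suc)
      have "\<bar>\<phi> z - \<phi> (grid L N i, grid L N j)\<bar>
          \<le> Linf_norm (dx \<phi>) * \<bar>fst z - grid L N i\<bar> + Linf_norm (dy \<phi>) * \<bar>snd z - grid L N j\<bar>"
        using test_fun_Lipschitz[OF \<phi>, of "fst z" "snd z"] by simp
      also have "\<dots> \<le> Linf_norm (dx \<phi>) * ?h + Linf_norm (dy \<phi>) * ?h"
        using z nn by (intro add_mono mult_left_mono) auto
      finally show ?thesis unfolding d_def distrib_right .
    qed
    have prem: "integrable (lebesgue_on (?C i j)) \<rho>" "\<omega> \<in> borel_measurable (lebesgue_on (?C i j))"
      "AE z in lebesgue_on (?C i j). \<bar>\<omega> z\<bar> \<le> S" "\<phi> \<in> borel_measurable (lebesgue_on (?C i j))"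
      "AE z in lebesgue_on (?C i j). \<bar>w i j - \<omega> z\<bar> \<le> \<kappa>"
      "?a i j * measure (lebesgue_on (?C i j)) (space (lebesgue_on (?C i j)))
        = (LINT z|lebesgue_on (?C i j). \<rho> z)"
      using \<rho>_on[OF cell_lebesgue] \<omega>_bd osc[of i j] a
      by (auto simp: AE_lebesgue_on_cell LINT_lebesgue_on_cell integrable_lebesgue_on_cell
          measure_lebesgue_on_cell[OF L(1)] intro: measurable_restrict_space1
          elim!: eventually_mono)
    note err = average_replacement_error[OF prem(1) \<rho>_bd prem(2,3,4) \<phi>_bd AE_I2[OF \<phi>_osc]
        w_bd[of i j] prem(5) a_nn prem(6) d]
    show "set_integrable lebesgue (?C i j) (?E i j)"
      using err(1) by (simp add: integrable_lebesgue_on_cell)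
    show "\<bar>LINT z:?C i j|lebesgue. ?E i j z\<bar>
        \<le> S * d * ((LINT z:?C i j|lebesgue. \<rho> z) + ?P * ?h\<^sup>2) + \<kappa> * ?\<Phi> * (LINT z:?C i j|lebesgue. \<rho> z)"
      using err(2) by (simp only: LINT_lebesgue_on_cell space_lebesgue_on measure_lebesgue_on_cell[OF L(1)])
  qed

  have \<phi>_on: "set_integrable lebesgue (?C i j) \<phi>" for i j
    by (rule set_integrable_bounded_cell[OF L(1), where C = ?\<Phi>]) (use \<phi>_bd in auto)
  \<comment> \<open>The scaled form in which \<open>set_integrable\<close> is defined.\<close>
  have step_split: "(\<Sum>i<N. \<Sum>j<N. ?a i j * w i j * indicator (?C i j) z) * \<phi> z
      = (\<Sum>i<N. \<Sum>j<N. (?a i j * w i j) * (indicator (?C i j) z *\<^sub>R \<phi> z))" for z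
    by (simp only: sum_distrib_right real_scaleR_def mult.assoc)
  have step_int: "integrable lebesgue (\<lambda>z. (\<Sum>i<N. \<Sum>j<N. ?a i j * w i j * indicator (?C i j) z) * \<phi> z)"
    unfolding step_split using \<phi>_on unfolding set_integrable_def
    by (intro Bochner_Integration.integrable_sum integrable_mult_right) auto
  have pointwise: "(\<Sum>i<N. \<Sum>j<N. ?a i j * w i j * indicator (?C i j) z) * \<phi> z - ?G z
      = (\<Sum>i<N. \<Sum>j<N. indicator (?C i j) z *\<^sub>R ?E i j z) - indicator (- ?Q) z *\<^sub>R ?G z" for z
  proof -
    have "(\<Sum>i<N. \<Sum>j<N. indicator (?C i j) z *\<^sub>R ?E i j z)
        = (\<Sum>i<N. \<Sum>j<N. ?a i j * w i j * indicator (?C i j) z) * \<phi> z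
          - (\<Sum>i<N. \<Sum>j<N. indicator (?C i j) z) * ?G z"
      by (simp add: sum_distrib_left sum_distrib_right sum_subtractf right_diff_distrib ac_simps)
    then show ?thesis
      unfolding sum_indicator_cell[OF L] by (simp add: indicator_def)
  qed
  have tail_le: "\<bar>LINT z:- ?Q|lebesgue. ?G z\<bar> \<le> \<epsilon> * ?\<Phi> * S"
  proof -
    have "\<bar>LINT z:- ?Q|lebesgue. ?G z\<bar> \<le> (LINT z:- ?Q|lebesgue. S * ?\<Phi> * \<rho> z)"
      unfolding set_lebesgue_integral_def
    proof (rule order_trans[OF integral_abs_bound integral_mono_AE])
      show "AE z in lebesgue. \<bar>indicator (- ?Q) z *\<^sub>R ?G z\<bar> \<le> indicator (- ?Q) z *\<^sub>R (S * ?\<Phi> * \<rho> z)"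
        using G_le by eventually_elim (simp split: split_indicator)
      show "integrable lebesgue (\<lambda>z. \<bar>indicator (- ?Q) z *\<^sub>R ?G z\<bar>)"
        by (rule integrable_abs[OF integrable_mult_indicator[OF Qc G_int]])
      show "integrable lebesgue (\<lambda>z. indicator (- ?Q) z *\<^sub>R (S * ?\<Phi> * \<rho> z))"
        by (intro integrable_mult_indicator[OF Qc] integrable_mult_right \<rho>(1))
    qed
    also have "\<dots> = S * ?\<Phi> * (LINT z:- ?Q|lebesgue. \<rho> z)"
      by (simp only: set_integral_mult_right)
    also have "(LINT z:- ?Q|lebesgue. \<rho> z) = (LINT z:(UNIV - {-L..L} \<times> {-L..L})|lebesgue. \<rho> z)"
      unfolding set_lebesgue_integral_def
    proof (rule integral_cong_AE)
      show "AE z in lebesgue. indicator (- ?Q) z *\<^sub>R \<rho> z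
          = indicator (UNIV - {-L..L} \<times> {-L..L}) z *\<^sub>R \<rho> z"
        using AE_closed_rectangle_iff_half_open[of "-L" L "-L" L]
        by eventually_elim (auto simp: indicator_def)
    qed measurable
    also have "S * ?\<Phi> * \<dots> \<le> S * ?\<Phi> * \<epsilon>"
      using tail nn by (intro mult_left_mono) auto
    finally show ?thesis by (simp add: ac_simps)
  qed
  have mass: "(\<Sum>i<N. \<Sum>j<N. LINT z:?C i j|lebesgue. \<rho> z) \<le> L1_norm \<rho>"
  proof -
    have "(\<Sum>i<N. \<Sum>j<N. LINT z:?C i j|lebesgue. \<rho> z)
        = (LINT z|lebesgue. (\<Sum>i<N. \<Sum>j<N. indicator (?C i j) z *\<^sub>R \<rho> z))"
      using \<rho>_on[OF cell_lebesgue] unfolding set_integrable_def set_lebesgue_integral_def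
      by (simp only: Bochner_Integration.integral_sum Bochner_Integration.integrable_sum)
    also have "\<dots> = (LINT z|lebesgue. indicator ?Q z * \<rho> z)"
      by (simp only: real_scaleR_def sum_distrib_right[symmetric] sum_indicator_cell[OF L])
    also have "\<dots> \<le> (LINT z|lebesgue. \<bar>\<rho> z\<bar>)"
      using \<rho>(1) \<rho>_on[OF Q(1)] unfolding set_integrable_def
      by (intro integral_mono) (auto split: split_indicator)
    finally show ?thesis by (simp add: L1_norm_def)
  qed
  have \<kappa>: "\<kappa> * ?\<Phi> * (\<Sum>i<N. \<Sum>j<N. LINT z:?C i j|lebesgue. \<rho> z) \<le> \<kappa> * ?\<Phi> * L1_norm \<rho>"
  proof -
    \<comment> \<open>The oscillation bound holds on a cell, which has positive measure.\<close>
    have "\<kappa> \<ge> 0"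
    proof (rule ccontr)
      assume "\<not> \<kappa> \<ge> 0"
      then have "AE z in lebesgue. z \<notin> ?C 0 0"
        using osc[of 0 0] by (auto elim!: eventually_mono)
      then have "?C 0 0 \<in> null_sets lebesgue"
        using cell_lebesgue by (simp add: AE_iff_null_sets)
      then have "ennreal (?h\<^sup>2) = 0"
        unfolding emeasure_cell[OF L(1), of N 0 0, symmetric] by (rule null_setsD1)
      then show False using zero_less_power[OF h, of 2] unfolding ennreal_eq_0_iff by linarith
    qed
    then show ?thesis using mass nn by (intro mult_left_mono) auto
  qed
  have "(LINT z|lebesgue. (\<Sum>i<N. \<Sum>j<N. ?a i j * w i j * indicator (?C i j) z) * \<phi> z)
      - (LINT z|lebesgue. ?G z)
    = (LINT z|lebesgue. (\<Sum>i<N. \<Sum>j<N. indicator (?C i j) z *\<^sub>R ?E i j z) - indicator (- ?Q) z *\<^sub>R ?G z)"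
    unfolding pointwise[symmetric] by (rule Bochner_Integration.integral_diff[OF step_int G_int, symmetric])
  also have "\<dots> = (\<Sum>i<N. \<Sum>j<N. LINT z:?C i j|lebesgue. ?E i j z) - (LINT z:- ?Q|lebesgue. ?G z)"
  proof -
    have "integrable lebesgue (\<lambda>z. indicator (- ?Q) z *\<^sub>R ?G z)"
      by (rule integrable_mult_indicator[OF Qc G_int])
    moreover have "integrable lebesgue (\<lambda>z. indicator (?C i j) z *\<^sub>R ?E i j z)" for i j
      using cell_error(1) by (simp add: set_integrable_def)
    ultimately show ?thesis
      unfolding set_lebesgue_integral_def
      by (simp only: Bochner_Integration.integral_diff Bochner_Integration.integral_sum
          Bochner_Integration.integrable_sum)
  qed
  finally have split: "(LINT z|lebesgue. (\<Sum>i<N. \<Sum>j<N. ?a i j * w i j * indicator (?C i j) z) * \<phi> z)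
      - (LINT z|lebesgue. ?G z)
    = (\<Sum>i<N. \<Sum>j<N. LINT z:?C i j|lebesgue. ?E i j z) - (LINT z:- ?Q|lebesgue. ?G z)" .
  have total: "\<bar>(LINT z|lebesgue. (\<Sum>i<N. \<Sum>j<N. ?a i j * w i j * indicator (?C i j) z) * \<phi> z)
      - (LINT z|lebesgue. ?G z)\<bar>
    \<le> (\<Sum>i<N. \<Sum>j<N. \<bar>LINT z:?C i j|lebesgue. ?E i j z\<bar>) + \<epsilon> * ?\<Phi> * S"
    unfolding split
  proof (rule order_trans[OF abs_triangle_ineq4 add_mono[OF _ tail_le]])
    show "\<bar>\<Sum>i<N. \<Sum>j<N. LINT z:?C i j|lebesgue. ?E i j z\<bar>
        \<le> (\<Sum>i<N. \<Sum>j<N. \<bar>LINT z:?C i j|lebesgue. ?E i j z\<bar>)"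
      by (rule order_trans[OF sum_abs sum_mono[OF sum_abs]])
  qed
  let ?M = "\<Sum>i<N. \<Sum>j<N. LINT z:?C i j|lebesgue. \<rho> z"
  have area: "real N * (real N * ?h\<^sup>2) = 4 * L\<^sup>2"
    using L by (simp add: power2_eq_square)
  have "(\<Sum>i<N. \<Sum>j<N. \<bar>LINT z:?C i j|lebesgue. ?E i j z\<bar>)
      \<le> (\<Sum>i<N. \<Sum>j<N. S * d * ((LINT z:?C i j|lebesgue. \<rho> z) + ?P * ?h\<^sup>2)
          + \<kappa> * ?\<Phi> * (LINT z:?C i j|lebesgue. \<rho> z))"
    by (intro sum_mono cell_error(2))
  also have "\<dots> = S * d * (?M + ?P * (4 * L\<^sup>2)) + \<kappa> * ?\<Phi> * ?M"
    by (simp only: sum.distrib sum_distrib_left[symmetric] sum_constant card_lessThan area)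
  also have "\<dots> \<le> S * d * (L1_norm \<rho> + ?P * (4 * L\<^sup>2)) + \<kappa> * ?\<Phi> * L1_norm \<rho>"
    using mass nn d by (intro add_mono[OF _ \<kappa>] mult_left_mono add_right_mono mult_nonneg_nonneg) auto
  also have "\<dots> = D_const L \<rho> \<phi> * S / real N + \<kappa> * ?\<Phi> * L1_norm \<rho>"
    by (simp add: d_def D_const_def ac_simps)
  finally show ?thesis using total by linarith
qed

theorem theorem1p4:
  fixes \<rho>0 :: "real \<times> real \<Rightarrow> real" and \<epsilon> L :: real
  assumes "integrable lebesgue \<rho>0" and "Linf \<rho>0"
    and "AE z in lebesgue. \<rho>0 z \<ge> 0"
    and "\<epsilon> > 0" and "L > 0"
    and "(LINT z:(UNIV - {-L..L} \<times> {-L..L})|lebesgue. \<rho>0 z) \<le> \<epsilon>"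
  shows "(\<forall>\<phi> N. test_fun \<phi> \<longrightarrow> N \<ge> 1 \<longrightarrow>
           \<bar>(LINT z|lebesgue. rho_hat L N \<rho>0 z * \<phi> z) - (LINT z|lebesgue. \<rho>0 z * \<phi> z)\<bar>
             \<le> \<epsilon> * Linf_norm \<phi> + D_const L \<rho>0 \<phi> / real N)
       \<and> (\<forall>\<omega>0 \<omega>x \<omega>y. Linf \<omega>0 \<longrightarrow> weak_dx \<omega>0 \<omega>x \<longrightarrow> weak_dy \<omega>0 \<omega>y \<longrightarrow> Linf \<omega>x \<longrightarrow> Linf \<omega>y \<longrightarrow>
           (\<forall>\<phi> N. test_fun \<phi> \<longrightarrow> N \<ge> 1 \<longrightarrow>
             \<bar>(LINT z|lebesgue. rho_omega_hat L N \<rho>0 \<omega>0 z * \<phi> z)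
                - (LINT z|lebesgue. \<rho>0 z * \<omega>0 z * \<phi> z)\<bar>
               \<le> \<epsilon> * Linf_norm \<phi> * Linf_norm \<omega>0
                  + (K_const L \<rho>0 \<omega>x \<omega>y \<phi> + D_const L \<rho>0 \<phi> * Linf_norm \<omega>0) / real N))"
proof (intro conjI allI impI)
  fix \<phi> and N :: nat
  assume \<phi>: "test_fun \<phi>" and N: "N \<ge> 1"
  have "rho_hat L N \<rho>0
      = (\<lambda>z. \<Sum>i<N. \<Sum>j<N. cell_avg L N \<rho>0 i j * 1 * indicator (cell L N i j) z)"
    by (simp add: rho_hat_def fun_eq_iff cell_def indicator_times mult.assoc)
  then show "\<bar>(LINT z|lebesgue. rho_hat L N \<rho>0 z * \<phi> z) - (LINT z|lebesgue. \<rho>0 z * \<phi> z)\<bar>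
      \<le> \<epsilon> * Linf_norm \<phi> + D_const L \<rho>0 \<phi> / real N"
    using weighted_grid_error[OF assms(1-3,5) N assms(6) \<phi>,
        where \<omega> = "\<lambda>z. 1" and S = 1 and w = "\<lambda>i j. 1" and \<kappa> = 0] by simp
next
  fix \<omega>0 \<omega>x \<omega>y \<phi> and N :: nat
  assume \<omega>: "Linf \<omega>0" "weak_dx \<omega>0 \<omega>x" "weak_dy \<omega>0 \<omega>y" "Linf \<omega>x" "Linf \<omega>y"
    and \<phi>: "test_fun \<phi>" and N: "N \<ge> 1"
  let ?h = "2 * L / real N" and ?A = "Linf_norm \<omega>x" and ?B = "Linf_norm \<omega>y"
  have \<omega>m: "\<omega>0 \<in> borel_measurable lebesgue" using \<omega>(1) by (simp add: Linf_def)
  have on: "set_integrable lebesgue (cell L N i j) \<omega>0" for i j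
    by (rule set_integrable_bounded_cell[OF assms(5) \<omega>m Linf_AE_bound[OF \<omega>(1)]])
  have osc: "AE z in lebesgue. z \<in> cell L N i j \<longrightarrow> \<bar>cell_avg L N \<omega>0 i j - \<omega>0 z\<bar> \<le> (?A + ?B) * ?h" for i j
    using weak_derivatives_AE_Lipschitz[OF \<omega>]
  proof eventually_elim
    case (elim z)
    show ?case
    proof
      assume z: "z \<in> cell L N i j"
      show "\<bar>cell_avg L N \<omega>0 i j - \<omega>0 z\<bar> \<le> (?A + ?B) * ?h"
      proof (rule cell_avg_sub_le[OF assms(5) N on \<omega>m])
        show "AE z' in lebesgue. z' \<in> cell L N i j \<longrightarrow> \<bar>\<omega>0 z' - \<omega>0 z\<bar> \<le> (?A + ?B) * ?h"
          using elim
        proof eventually_elim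
          case (elim z')
          show ?case
          proof
            assume "z' \<in> cell L N i j"
            from cell_width[OF this z]
            have "?A * \<bar>fst z' - fst z\<bar> + ?B * \<bar>snd z' - snd z\<bar> \<le> ?A * ?h + ?B * ?h"
              using Linf_norm_nonneg[OF \<omega>(4)] Linf_norm_nonneg[OF \<omega>(5)]
              by (intro add_mono mult_left_mono) auto
            then show "\<bar>\<omega>0 z' - \<omega>0 z\<bar> \<le> (?A + ?B) * ?h"
              using elim unfolding distrib_right by linarith
          qed
        qed
      qed
    qed
  qed
  have bd: "\<bar>cell_avg L N \<omega>0 i j\<bar> \<le> Linf_norm \<omega>0" for i j
  proof -
    have "AE z in lebesgue. z \<in> cell L N i j \<longrightarrow> \<bar>\<omega>0 z - 0\<bar> \<le> Linf_norm \<omega>0"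
      using Linf_AE_bound[OF \<omega>(1)] by eventually_elim simp
    from cell_avg_sub_le[OF assms(5) N on \<omega>m this] show ?thesis by simp
  qed
  have hat: "rho_omega_hat L N \<rho>0 \<omega>0
      = (\<lambda>z. \<Sum>i<N. \<Sum>j<N. cell_avg L N \<rho>0 i j * cell_avg L N \<omega>0 i j * indicator (cell L N i j) z)"
    by (simp add: rho_omega_hat_def fun_eq_iff cell_def indicator_times mult.assoc)
  have K: "(?A + ?B) * ?h * Linf_norm \<phi> * L1_norm \<rho>0 = K_const L \<rho>0 \<omega>x \<omega>y \<phi> / real N"
    by (simp add: K_const_def ac_simps)
  show "\<bar>(LINT z|lebesgue. rho_omega_hat L N \<rho>0 \<omega>0 z * \<phi> z)
        - (LINT z|lebesgue. \<rho>0 z * \<omega>0 z * \<phi> z)\<bar>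
      \<le> \<epsilon> * Linf_norm \<phi> * Linf_norm \<omega>0
        + (K_const L \<rho>0 \<omega>x \<omega>y \<phi> + D_const L \<rho>0 \<phi> * Linf_norm \<omega>0) / real N"
    using weighted_grid_error[OF assms(1-3,5) N assms(6) \<phi> \<omega>m Linf_AE_bound[OF \<omega>(1)] bd osc]
    unfolding hat K add_divide_distrib by linarith
qed

end
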